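(* Let $L=F/R$ be a finite Lie ring, where $F$ is a free Lie ring and $R$ is an ideal of $F$. Consider $\mathbb{C}^*$ as a trivial $L$-module. Then \[ H^2(L,\mathbb{C}^* )\cong (R\cap F^2)/[F,R]. \]
   Context: A Lie ring is an additive abelian group with a biadditive bracket $[\cdot,\cdot]$ satisfying $[x,x]=0$ and the Jacobi identity (i.e. a Lie algebra over $\mathbb{Z}$); free Lie rings are the free objects in this category. For Lie subrings $U,V$ of a Lie ring, $[U,V]$ is the Lie subring generated by all $[u,v]$ with $u\in U$, $v\in V$, and $U^2=[U,U]$. $\mathbb{C}^*$ is the multiplicative group of nonzero complex numbers; an abelian group is regarded as a Lie ring with zero bracket. For a Lie ring $L$ and a trivial $L$-module $A$ (an abelian group, written additively), $Z^2(L,A)$ is the abelian group (under pointwise addition) of all pairs $(f,g)$ of functions $f,g:L\times L\to A$ such that for all $x,y,z\in L$: (1) $f(x+y,z)=f(x,z)+f(y,z)+g([x,z],[y,z])$ and $f(x,y+z)=f(x,y)+f(x,z)+g([x,y],[x,z])$; (2) $f(x,x)=0$; (3) $f(x,[y,z])+f(z,[x,y])+f(y,[z,x])=-g([x,[y,z]],[z,[x,y]])-g(-[y,[z,x]],[y,[z,x]])$; (4) $g(x+y,z)+g(x,y)=g(x,y+z)+g(y,z)$; (5) $g(x,y)=g(y,x)$. $B^2(L,A)$ is the subgroup of pairs $(f,g)$ of the form $f(x,y)=-t([x,y])$, $g(x,y)=t(x)+t(y)-t(x+y)$ for some map $t:L\to A$ with $t(0)=0$. The second cohomology group is $H^2(L,A)=Z^2(L,A)/B^2(L,A)$.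 *)

theory Defs
  imports Complex_Main "HOL-Algebra.Algebra"
begin

section \<open>Lie rings\<close>

text \<open>
  A Lie ring lives on the \<open>ring\<close> record of HOL-Algebra: \<open>\<oplus>\<close>, \<open>\<zero>\<close> is the additive group and
  \<open>\<otimes>\<close> is the bracket. The field \<open>\<one>\<close> of the record is not used, as in \<^locale>\<open>abelian_group\<close>;
  no Lie ring notion below depends on it.
\<close>

locale lie_ring = abelian_group L for L (structure) +
  assumes bracket_closed: "\<lbrakk>x \<in> carrier L; y \<in> carrier L\<rbrakk> \<Longrightarrow> x \<otimes> y \<in> carrier L"
    and bracket_add_left: "\<lbrakk>x \<in> carrier L; y \<in> carrier L; z \<in> carrier L\<rbrakk>
      \<Longrightarrow> (x \<oplus> y) \<otimes> z = (x \<otimes> z) \<oplus> (y \<otimes> z)"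
    and bracket_add_right: "\<lbrakk>x \<in> carrier L; y \<in> carrier L; z \<in> carrier L\<rbrakk>
      \<Longrightarrow> x \<otimes> (y \<oplus> z) = (x \<otimes> y) \<oplus> (x \<otimes> z)"
    and bracket_self: "x \<in> carrier L \<Longrightarrow> x \<otimes> x = \<zero>"
    and jacobi: "\<lbrakk>x \<in> carrier L; y \<in> carrier L; z \<in> carrier L\<rbrakk>
      \<Longrightarrow> (x \<otimes> (y \<otimes> z)) \<oplus> (y \<otimes> (z \<otimes> x)) \<oplus> (z \<otimes> (x \<otimes> y)) = \<zero>"

locale lie_subring = additive_subgroup U L for U and L (structure) +
  assumes bracket_mem: "\<lbrakk>x \<in> U; y \<in> U\<rbrakk> \<Longrightarrow> x \<otimes> y \<in> U"

locale lie_ideal = additive_subgroup I L for I and L (structure) +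
  assumes bracket_mem_left: "\<lbrakk>x \<in> carrier L; a \<in> I\<rbrakk> \<Longrightarrow> x \<otimes> a \<in> I"
    and bracket_mem_right: "\<lbrakk>x \<in> carrier L; a \<in> I\<rbrakk> \<Longrightarrow> a \<otimes> x \<in> I"

definition lie_generate :: "('a, 'm) ring_scheme \<Rightarrow> 'a set \<Rightarrow> 'a set" where
  "lie_generate L S = \<Inter>{U. lie_subring U L \<and> S \<subseteq> U}"

definition lie_bracket :: "('a, 'm) ring_scheme \<Rightarrow> 'a set \<Rightarrow> 'a set \<Rightarrow> 'a set" where
  "lie_bracket L U V = lie_generate L {u \<otimes>\<^bsub>L\<^esub> v | u v. u \<in> U \<and> v \<in> V}"

definition lie_hom :: "('a, 'm) ring_scheme \<Rightarrow> ('b, 'n) ring_scheme \<Rightarrow> ('a \<Rightarrow> 'b) set" where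
  "lie_hom L M = {h \<in> carrier L \<rightarrow> carrier M.
     \<forall>x \<in> carrier L. \<forall>y \<in> carrier L.
       h (x \<oplus>\<^bsub>L\<^esub> y) = h x \<oplus>\<^bsub>M\<^esub> h y \<and> h (x \<otimes>\<^bsub>L\<^esub> y) = h x \<otimes>\<^bsub>M\<^esub> h y}"


section \<open>Free Lie rings\<close>

text \<open>
  Freeness is the usual universal property. A HOL definition cannot quantify over the types that
  carry the target Lie rings, so the targets are taken in one type that is large enough, the sets
  of formal Lie expressions in elements of \<open>'a\<close>. Lemma \<open>lie_basis_universal\<close> shows that
  nothing is lost: the universal property then holds for target Lie rings over every type.
\<close>

datatype (lie_vars: 'a) lie_expr =
  Gen 'a | Zero | Neg "'a lie_expr"
| Add "'a lie_expr" "'a lie_expr" | Bracket "'a lie_expr" "'a lie_expr"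

definition lie_basis :: "('a, 'm) ring_scheme \<Rightarrow> 'a set \<Rightarrow> bool" where
  "lie_basis F B \<longleftrightarrow> B \<subseteq> carrier F \<and>
     (\<forall>(M :: 'a lie_expr set ring) \<phi>. lie_ring M \<and> \<phi> \<in> B \<rightarrow> carrier M \<longrightarrow>
        (\<exists>!h. h \<in> lie_hom F M \<and> h \<in> extensional (carrier F) \<and> (\<forall>x \<in> B. h x = \<phi> x)))"

definition free_lie_ring :: "('a, 'm) ring_scheme \<Rightarrow> bool" where
  "free_lie_ring F \<longleftrightarrow> lie_ring F \<and> (\<exists>B. lie_basis F B)"

subsection \<open>The universal property holds over every type\<close>

definition lie_image :: "('a \<Rightarrow> 'b) \<Rightarrow> 'a set \<Rightarrow> ('a, 'm) ring_scheme \<Rightarrow> 'b ring" where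
  "lie_image j K M = \<lparr>carrier = j ` K,
     monoid.mult = (\<lambda>x y. j (inv_into K j x \<otimes>\<^bsub>M\<^esub> inv_into K j y)), one = j \<zero>\<^bsub>M\<^esub>,
     ring.zero = j \<zero>\<^bsub>M\<^esub>, add = (\<lambda>x y. j (inv_into K j x \<oplus>\<^bsub>M\<^esub> inv_into K j y))\<rparr>"

lemma lie_image_simps:
  "carrier (lie_image j K M) = j ` K"
  "\<zero>\<^bsub>lie_image j K M\<^esub> = j \<zero>\<^bsub>M\<^esub>"
  "inj_on j K \<Longrightarrow> x \<in> K \<Longrightarrow> y \<in> K \<Longrightarrow> j x \<otimes>\<^bsub>lie_image j K M\<^esub> j y = j (x \<otimes>\<^bsub>M\<^esub> y)"
  "inj_on j K \<Longrightarrow> x \<in> K \<Longrightarrow> y \<in> K \<Longrightarrow> j x \<oplus>\<^bsub>lie_image j K M\<^esub> j y = j (x \<oplus>\<^bsub>M\<^esub> y)"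
  by (simp_all add: lie_image_def)

lemma lie_ring_lie_image:
  assumes M: "lie_ring M" and K: "lie_subring K M" and inj: "inj_on j K"
  shows "lie_ring (lie_image j K M)"
proof -
  interpret M: lie_ring M by fact
  interpret K: lie_subring K M by fact
  note [simp] = lie_image_simps inj K.a_closed K.bracket_mem K.zero_closed
  have KM: "x \<in> carrier M" if "x \<in> K" for x using that K.a_subset by blast
  have "abelian_group (lie_image j K M)"
  proof (rule abelian_groupI)
    fix x assume "x \<in> carrier (lie_image j K M)"
    then obtain a where a: "a \<in> K" "x = j a" by auto
    have "\<ominus>\<^bsub>M\<^esub> a \<in> K" using a K.a_inv_closed M.abelian_group_axioms by blast
    moreover have "j (\<ominus>\<^bsub>M\<^esub> a) \<oplus>\<^bsub>lie_image j K M\<^esub> x = \<zero>\<^bsub>lie_image j K M\<^esub>"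
      using a calculation KM by (simp add: M.l_neg)
    ultimately show "\<exists>y\<in>carrier (lie_image j K M). y \<oplus>\<^bsub>lie_image j K M\<^esub> x = \<zero>\<^bsub>lie_image j K M\<^esub>"
      by auto
  qed (auto simp: KM M.a_ac)
  then show ?thesis
    by (intro lie_ring.intro lie_ring_axioms.intro)
      (auto simp: KM M.bracket_add_left M.bracket_add_right M.bracket_self M.jacobi)
qed

fun lie_eval :: "('b, 'm) ring_scheme \<Rightarrow> ('a \<Rightarrow> 'b) \<Rightarrow> 'a lie_expr \<Rightarrow> 'b" where
  "lie_eval M \<phi> (Gen a) = \<phi> a"
| "lie_eval M \<phi> Zero = \<zero>\<^bsub>M\<^esub>"
| "lie_eval M \<phi> (Neg s) = \<ominus>\<^bsub>M\<^esub> lie_eval M \<phi> s"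
| "lie_eval M \<phi> (Add s t) = lie_eval M \<phi> s \<oplus>\<^bsub>M\<^esub> lie_eval M \<phi> t"
| "lie_eval M \<phi> (Bracket s t) = lie_eval M \<phi> s \<otimes>\<^bsub>M\<^esub> lie_eval M \<phi> t"

lemma lie_subringI:
  assumes "lie_ring M" "K \<subseteq> carrier M" "\<zero>\<^bsub>M\<^esub> \<in> K" "\<And>x. x \<in> K \<Longrightarrow> \<ominus>\<^bsub>M\<^esub> x \<in> K"
    "\<And>x y. x \<in> K \<Longrightarrow> y \<in> K \<Longrightarrow> x \<oplus>\<^bsub>M\<^esub> y \<in> K" "\<And>x y. x \<in> K \<Longrightarrow> y \<in> K \<Longrightarrow> x \<otimes>\<^bsub>M\<^esub> y \<in> K"
  shows "lie_subring K M"
proof -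
  interpret M: lie_ring M by fact
  show ?thesis
    using assms
    by (intro lie_subring.intro additive_subgroup.intro lie_subring_axioms.intro
        subgroup.intro) (auto simp: a_inv_def)
qed

lemma lie_hom_zero:
  assumes "lie_ring L" "lie_ring M" "h \<in> lie_hom L M"
  shows "h \<zero>\<^bsub>L\<^esub> = \<zero>\<^bsub>M\<^esub>"
proof -
  interpret L: lie_ring L by fact
  interpret M: lie_ring M by fact
  have "h \<zero>\<^bsub>L\<^esub> \<in> carrier M" "h (\<zero>\<^bsub>L\<^esub> \<oplus>\<^bsub>L\<^esub> \<zero>\<^bsub>L\<^esub>) = h \<zero>\<^bsub>L\<^esub> \<oplus>\<^bsub>M\<^esub> h \<zero>\<^bsub>L\<^esub>"
    using assms(3) L.zero_closed unfolding lie_hom_def by blast+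
  then show ?thesis by simp
qed

lemma lie_hom_neg:
  assumes "lie_ring L" "lie_ring M" "h \<in> lie_hom L M" "x \<in> carrier L"
  shows "h (\<ominus>\<^bsub>L\<^esub> x) = \<ominus>\<^bsub>M\<^esub> h x"
proof -
  interpret L: lie_ring L by fact
  interpret M: lie_ring M by fact
  have "h x \<in> carrier M" "h (\<ominus>\<^bsub>L\<^esub> x) \<in> carrier M"
    "h (\<ominus>\<^bsub>L\<^esub> x \<oplus>\<^bsub>L\<^esub> x) = h (\<ominus>\<^bsub>L\<^esub> x) \<oplus>\<^bsub>M\<^esub> h x"
    using assms(3,4) by (auto simp: lie_hom_def)
  then show ?thesis using assms lie_hom_zero[OF assms(1-3)]
    by (metis L.l_neg M.minus_equality)
qed

lemma lie_subring_eval: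
  assumes M: "lie_ring M" and \<phi>: "\<phi> \<in> B \<rightarrow> carrier M"
  shows "lie_subring (lie_eval M \<phi> ` {e. lie_vars e \<subseteq> B}) M"
proof -
  interpret M: lie_ring M by fact
  let ?T = "{e. lie_vars e \<subseteq> B}"
  let ?K = "lie_eval M \<phi> ` ?T"
  have "lie_eval M \<phi> e \<in> carrier M" if "lie_vars e \<subseteq> B" for e
    using that \<phi> by (induction e) (auto simp: M.bracket_closed)
  moreover have "\<zero>\<^bsub>M\<^esub> \<in> ?K" by (rule image_eqI[of _ _ Zero]) auto
  moreover have "\<ominus>\<^bsub>M\<^esub> x \<in> ?K" if "x \<in> ?K" for x
  proof -
    obtain s where "s \<in> ?T" "x = lie_eval M \<phi> s" using \<open>x \<in> ?K\<close> by auto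
    then show ?thesis by (intro image_eqI[of _ _ "Neg s"]) auto
  qed
  moreover have "x \<oplus>\<^bsub>M\<^esub> y \<in> ?K" "x \<otimes>\<^bsub>M\<^esub> y \<in> ?K" if xy: "x \<in> ?K" "y \<in> ?K" for x y
  proof -
    obtain s t where "s \<in> ?T" "x = lie_eval M \<phi> s" "t \<in> ?T" "y = lie_eval M \<phi> t"
      using xy by fast
    then have "lie_eval M \<phi> (Add s t) \<in> ?K" "lie_eval M \<phi> (Bracket s t) \<in> ?K"
      by (intro imageI; simp)+
    then show "x \<oplus>\<^bsub>M\<^esub> y \<in> ?K" "x \<otimes>\<^bsub>M\<^esub> y \<in> ?K"
      using \<open>x = _\<close> \<open>y = _\<close> by simp_all
  qed
  ultimately show ?thesis by (intro lie_subringI[OF M]) auto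
qed

lemma lie_basis_generates:
  assumes F: "lie_ring F" and B: "lie_basis F B" and E: "lie_subring E F" and BE: "B \<subseteq> E"
  shows "E = carrier F"
proof -
  interpret F: lie_ring F by fact
  interpret E: lie_subring E F by fact
  define j where "j = (\<lambda>a :: 'a. {Gen a})"
  have inj: "inj_on j A" for A by (auto simp: inj_on_def j_def)
  have cF: "lie_subring (carrier F) F"
    by (rule lie_subringI[OF F]) (auto simp: F.bracket_closed)
  let ?E = "lie_image j E F" and ?F = "lie_image j (carrier F) F"
  have EF: "E \<subseteq> carrier F" using E.a_subset .
  have "j \<in> B \<rightarrow> carrier ?E" using BE by (auto simp: lie_image_simps)
  then obtain h where h: "h \<in> lie_hom F ?E" "h \<in> extensional (carrier F)" "\<forall>x\<in>B. h x = j x"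
    using B lie_ring_lie_image[OF F E inj] unfolding lie_basis_def by metis
  have h_mem: "h x \<in> j ` E" if "x \<in> carrier F" for x
    using h(1) that by (auto simp: lie_hom_def lie_image_simps)
  have opE: "u \<oplus>\<^bsub>?E\<^esub> v = u \<oplus>\<^bsub>?F\<^esub> v" "u \<otimes>\<^bsub>?E\<^esub> v = u \<otimes>\<^bsub>?F\<^esub> v" if "u \<in> j ` E" "v \<in> j ` E" for u v
    using that EF by (auto simp: lie_image_simps inj subset_iff)
  have hF: "h \<in> lie_hom F ?F"
    using h(1) h_mem image_mono[OF EF, of j]
    by (auto simp: lie_hom_def opE lie_image_simps(1))
  let ?j = "restrict j (carrier F)"
  have jF: "?j \<in> lie_hom F ?F"
    by (auto simp: lie_hom_def lie_image_simps inj F.bracket_closed)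
  have "j \<in> B \<rightarrow> carrier ?F" using BE EF by (auto simp: lie_image_simps)
  then have "\<exists>!h. h \<in> lie_hom F ?F \<and> h \<in> extensional (carrier F) \<and> (\<forall>x\<in>B. h x = j x)"
    using B lie_ring_lie_image[OF F cF inj] unfolding lie_basis_def by blast
  moreover have "\<forall>x\<in>B. ?j x = j x" using BE EF by auto
  ultimately have "h = ?j" using hF jF h(2,3) by (metis restrict_extensional)
  then have "j x \<in> j ` E" if "x \<in> carrier F" for x using h_mem[OF that] that by simp
  then show ?thesis using EF by (auto simp: j_def)
qed

lemma lie_basis_universal:
  fixes M :: "('b, 'n) ring_scheme"
  assumes F: "lie_ring F" and B: "lie_basis F B"
    and M: "lie_ring M" and \<phi>: "\<phi> \<in> B \<rightarrow> carrier M"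
  shows "\<exists>!h. h \<in> lie_hom F M \<and> h \<in> extensional (carrier F) \<and> (\<forall>x \<in> B. h x = \<phi> x)"
proof (rule ex_ex1I)
  interpret F: lie_ring F by fact
  interpret M: lie_ring M by fact
  have BF: "B \<subseteq> carrier F" using B by (simp add: lie_basis_def)
  define T where "T = {e. lie_vars e \<subseteq> B}"
  define K where "K = lie_eval M \<phi> ` T"
  define \<iota> where "\<iota> = (\<lambda>y. {e \<in> T. lie_eval M \<phi> e = y})"
  have K: "lie_subring K M" unfolding K_def T_def by (rule lie_subring_eval[OF M \<phi>])
  have KM: "K \<subseteq> carrier M"
    using K additive_subgroup.a_subset lie_subring.axioms(1) by blast
  have inj: "inj_on \<iota> K" by (auto simp: inj_on_def \<iota>_def K_def)
  let ?N = "lie_image \<iota> K M"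
  have \<phi>K: "\<phi> x \<in> K" if "x \<in> B" for x
    unfolding K_def T_def using that by (intro image_eqI[of _ _ "Gen x"]) auto
  then have "(\<lambda>x. \<iota> (\<phi> x)) \<in> B \<rightarrow> carrier ?N" by (auto simp: lie_image_simps)
  then obtain h where h: "h \<in> lie_hom F ?N" "\<forall>x\<in>B. h x = \<iota> (\<phi> x)"
    using B lie_ring_lie_image[OF M K inj] unfolding lie_basis_def by metis
  define k where "k = (\<lambda>x\<in>carrier F. inv_into K \<iota> (h x))"
  have hm: "h x \<in> \<iota> ` K" if "x \<in> carrier F" for x
    using h(1) that by (auto simp: lie_hom_def lie_image_simps)
  have km: "k x \<in> K" "\<iota> (k x) = h x" if "x \<in> carrier F" for x
    using hm[OF that] that by (auto simp: k_def inv_into_into f_inv_into_f inj)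
  interpret K: lie_subring K M by fact
  have "k (x \<oplus>\<^bsub>F\<^esub> y) = k x \<oplus>\<^bsub>M\<^esub> k y \<and> k (x \<otimes>\<^bsub>F\<^esub> y) = k x \<otimes>\<^bsub>M\<^esub> k y"
    if xy: "x \<in> carrier F" "y \<in> carrier F" for x y
  proof -
    have "\<iota> (k (x \<oplus>\<^bsub>F\<^esub> y)) = h x \<oplus>\<^bsub>?N\<^esub> h y" "\<iota> (k (x \<otimes>\<^bsub>F\<^esub> y)) = h x \<otimes>\<^bsub>?N\<^esub> h y"
      using h(1) xy km(2) F.bracket_closed by (auto simp: lie_hom_def)
    then have "\<iota> (k (x \<oplus>\<^bsub>F\<^esub> y)) = \<iota> (k x \<oplus>\<^bsub>M\<^esub> k y)" "\<iota> (k (x \<otimes>\<^bsub>F\<^esub> y)) = \<iota> (k x \<otimes>\<^bsub>M\<^esub> k y)"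
      using xy km by (metis lie_image_simps(4) inj, metis lie_image_simps(3) inj)
    then show ?thesis
      using inj xy km(1) F.bracket_closed F.a_closed K.a_closed K.bracket_mem
      by (auto simp: inj_on_def)
  qed
  then have "k \<in> lie_hom F M" using km(1) KM by (auto simp: lie_hom_def)
  moreover have "k \<in> extensional (carrier F)" by (simp add: k_def)
  moreover have "\<forall>x\<in>B. k x = \<phi> x"
    using h(2) BF \<phi>K inj by (auto simp: k_def)
  ultimately show "\<exists>h. h \<in> lie_hom F M \<and> h \<in> extensional (carrier F) \<and> (\<forall>x\<in>B. h x = \<phi> x)"
    by blast
next
  interpret F: lie_ring F by fact
  interpret M: lie_ring M by fact
  have BF: "B \<subseteq> carrier F" using B by (simp add: lie_basis_def)
  fix h k
  assume h: "h \<in> lie_hom F M \<and> h \<in> extensional (carrier F) \<and> (\<forall>x\<in>B. h x = \<phi> x)"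
    and k: "k \<in> lie_hom F M \<and> k \<in> extensional (carrier F) \<and> (\<forall>x\<in>B. k x = \<phi> x)"
  let ?E = "{x \<in> carrier F. h x = k x}"
  have "lie_subring ?E F"
    using h k by (intro lie_subringI[OF F])
      (auto simp: lie_hom_zero[OF F M] lie_hom_neg[OF F M] F.bracket_closed,
       auto simp: lie_hom_def)
  moreover have "B \<subseteq> ?E" using h k BF by auto
  ultimately have "?E = carrier F" by (rule lie_basis_generates[OF F B])
  then show "h = k" using h k by (intro extensionalityI[of _ "carrier F"]) auto
qed


section \<open>The second cohomology group\<close>

text \<open>
  The coefficients \<open>A\<close> form an abelian group with trivial action, written multiplicatively here
  since \<open>\<complex>\<^sup>*\<close> is multiplicative: \<open>\<otimes>\<^bsub>A\<^esub>\<close>, \<open>inv\<^bsub>A\<^esub>\<close>, \<open>\<one>\<^bsub>A\<^esub>\<close> stand for \<open>+\<close>, \<open>-\<close>, \<open>0\<close> of \<open>A\<close>.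
  Maps \<open>L \<times> L \<rightarrow> A\<close> are elements of \<^const>\<open>product_group\<close>, i.e. \<^const>\<open>undefined\<close> outside
  \<open>carrier L \<times> carrier L\<close>, so that equality of maps is equality on \<open>L \<times> L\<close>.
\<close>

definition cochain2 :: "('a, 'm) ring_scheme \<Rightarrow> ('b, 'n) monoid_scheme
    \<Rightarrow> (('a \<times> 'a \<Rightarrow> 'b) \<times> ('a \<times> 'a \<Rightarrow> 'b)) monoid" where
  "cochain2 L A = product_group (carrier L \<times> carrier L) (\<lambda>_. A)
                  \<times>\<times> product_group (carrier L \<times> carrier L) (\<lambda>_. A)"

definition cocycle2 :: "('a, 'm) ring_scheme \<Rightarrow> ('b, 'n) monoid_scheme
    \<Rightarrow> ('a \<times> 'a \<Rightarrow> 'b) \<Rightarrow> ('a \<times> 'a \<Rightarrow> 'b) \<Rightarrow> bool" where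
  "cocycle2 L A f g \<longleftrightarrow>
     (\<forall>x \<in> carrier L. \<forall>y \<in> carrier L. \<forall>z \<in> carrier L.
        f (x \<oplus>\<^bsub>L\<^esub> y, z) = f (x, z) \<otimes>\<^bsub>A\<^esub> f (y, z) \<otimes>\<^bsub>A\<^esub> g (x \<otimes>\<^bsub>L\<^esub> z, y \<otimes>\<^bsub>L\<^esub> z) \<and>
        f (x, y \<oplus>\<^bsub>L\<^esub> z) = f (x, y) \<otimes>\<^bsub>A\<^esub> f (x, z) \<otimes>\<^bsub>A\<^esub> g (x \<otimes>\<^bsub>L\<^esub> y, x \<otimes>\<^bsub>L\<^esub> z) \<and>
        f (x, x) = \<one>\<^bsub>A\<^esub> \<and>
        f (x, y \<otimes>\<^bsub>L\<^esub> z) \<otimes>\<^bsub>A\<^esub> f (z, x \<otimes>\<^bsub>L\<^esub> y) \<otimes>\<^bsub>A\<^esub> f (y, z \<otimes>\<^bsub>L\<^esub> x) =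
          inv\<^bsub>A\<^esub> g (x \<otimes>\<^bsub>L\<^esub> (y \<otimes>\<^bsub>L\<^esub> z), z \<otimes>\<^bsub>L\<^esub> (x \<otimes>\<^bsub>L\<^esub> y)) \<otimes>\<^bsub>A\<^esub>
          inv\<^bsub>A\<^esub> g (\<ominus>\<^bsub>L\<^esub> (y \<otimes>\<^bsub>L\<^esub> (z \<otimes>\<^bsub>L\<^esub> x)), y \<otimes>\<^bsub>L\<^esub> (z \<otimes>\<^bsub>L\<^esub> x)) \<and>
        g (x \<oplus>\<^bsub>L\<^esub> y, z) \<otimes>\<^bsub>A\<^esub> g (x, y) = g (x, y \<oplus>\<^bsub>L\<^esub> z) \<otimes>\<^bsub>A\<^esub> g (y, z) \<and>
        g (x, y) = g (y, x))"

definition Z2 :: "('a, 'm) ring_scheme \<Rightarrow> ('b, 'n) monoid_scheme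
    \<Rightarrow> (('a \<times> 'a \<Rightarrow> 'b) \<times> ('a \<times> 'a \<Rightarrow> 'b)) monoid" where
  "Z2 L A = (cochain2 L A)\<lparr>carrier := {(f, g) \<in> carrier (cochain2 L A). cocycle2 L A f g}\<rparr>"

definition B2 :: "('a, 'm) ring_scheme \<Rightarrow> ('b, 'n) monoid_scheme
    \<Rightarrow> (('a \<times> 'a \<Rightarrow> 'b) \<times> ('a \<times> 'a \<Rightarrow> 'b)) set" where
  "B2 L A =
     {(\<lambda>(x, y) \<in> carrier L \<times> carrier L. inv\<^bsub>A\<^esub> t (x \<otimes>\<^bsub>L\<^esub> y),
       \<lambda>(x, y) \<in> carrier L \<times> carrier L. t x \<otimes>\<^bsub>A\<^esub> t y \<otimes>\<^bsub>A\<^esub> inv\<^bsub>A\<^esub> t (x \<oplus>\<^bsub>L\<^esub> y))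
      | t. t \<in> carrier L \<rightarrow> carrier A \<and> t \<zero>\<^bsub>L\<^esub> = \<one>\<^bsub>A\<^esub>}"

definition H2 :: "('a, 'm) ring_scheme \<Rightarrow> ('b, 'n) monoid_scheme
    \<Rightarrow> (('a \<times> 'a \<Rightarrow> 'b) \<times> ('a \<times> 'a \<Rightarrow> 'b)) set monoid" where
  "H2 L A = Z2 L A Mod B2 L A"

definition complex_units :: "complex monoid" where
  "complex_units = \<lparr>carrier = - {0}, monoid.mult = (*), one = 1\<rparr>"

end

theory Submission
  imports Defs
begin

text \<open>
  A cocycle \<open>(f, g)\<close> is the same as a central extension of \<open>L\<close> by \<open>\<complex>\<^sup>*\<close>. As \<open>F\<close> is free, \<open>F \<rightarrow> L\<close> lifts
  to this extension, and the \<open>\<complex>\<^sup>*\<close>-component \<open>c\<close> of such a lift satisfies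
  \<open>c (x + y) = c x \<cdot> c y \<cdot> g (x, y)\<close> and \<open>c [x, y] = f (x, y)\<close>. Two lifts differ by a homomorphism that
  kills brackets, so \<open>c\<close> is determined on \<open>F\<^sup>2\<close>; on \<open>R\<close> it is additive and trivial on \<open>[F, R]\<close>.
  Restriction to \<open>R \<inter> F\<^sup>2\<close> sends \<open>Z\<^sup>2\<close> to the characters of \<open>M = (R \<inter> F\<^sup>2) / [F, R]\<close>. Since \<open>\<complex>\<^sup>*\<close> is
  divisible, characters extend from subgroups, which makes this map surjective with kernel \<open>B\<^sup>2\<close>.
  As in Schur's theorem, \<open>F\<^sup>2 / [F, R]\<close> is generated by finitely many brackets of finite order, hence
  \<open>M\<close> is finite and isomorphic to its character group.
\<close>

section \<open>Extending characters of abelian groups\<close>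

text \<open>A lift \<open>c\<close> can be altered in two ways. Multiplying it by a character of the
  additive group of \<open>F\<close> that kills \<open>F^2\<close> gives another lift of the same
  pair; multiplying it by a function of the coset modulo \<open>R\<close>, equal to 1 at zero,
  changes the pair by a coboundary. If \<open>c\<close> is trivial on \<open>R \<inter> F^2\<close>,
  then its restriction to \<open>R\<close> extends to a character that kills \<open>F^2\<close>;
  after division by it \<open>c\<close> is constant on cosets, so the pair is a coboundary. For
  surjectivity, a character trivial on \<open>[F, R]\<close> is extended to all of \<open>F\<close>;
  its value at \<open>[x, y]\<close> depends only on the cosets of \<open>x\<close> and
  \<open>y\<close>, which is what allows a cocycle to be read off. The cocycle identities are long,
  so they are used only to build the extension. Afterwards a cocycle is handled as a pair that
  possesses a lift, and identities are replaced by operations on lifts. Self-duality rests on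
  splitting off a cyclic subgroup generated by an element whose order annihilates the whole group: a
  character faithful on that subgroup has its kernel as a complement.\<close>

lemma complex_units_simps [simp]:
  "carrier complex_units = - {0}" "x \<otimes>\<^bsub>complex_units\<^esub> y = x * y" "\<one>\<^bsub>complex_units\<^esub> = 1"
  by (simp_all add: complex_units_def)

interpretation complex_units: comm_group complex_units
proof (rule comm_groupI)
  fix x assume "x \<in> carrier complex_units"
  then show "\<exists>y\<in>carrier complex_units. y \<otimes>\<^bsub>complex_units\<^esub> x = \<one>\<^bsub>complex_units\<^esub>"
    by (intro bexI[of _ "inverse x"]) auto
qed auto

lemma complex_units_inv [simp]: "x \<noteq> 0 \<Longrightarrow> inv\<^bsub>complex_units\<^esub> x = inverse x"
  by (rule complex_units.inv_equality) auto

lemma complex_units_pow [simp]: "x [^]\<^bsub>complex_units\<^esub> (n::nat) = x ^ n"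
  by (induction n) auto

text \<open>This is the divisibility that makes characters extend from subgroups.\<close>

lemma complex_root_exists:
  assumes "n > 0"
  shows "\<exists>z::complex. z ^ n = w"
proof
  show "rcis (root n (cmod w)) (Arg w / real n) ^ n = w"
    using assms by (simp add: DeMoivre2 rcis_cmod_Arg)
qed

lemma int_pow_DirProd:
  assumes "group G" "group H" "x \<in> carrier G" "y \<in> carrier H"
  shows "(x, y) [^]\<^bsub>G \<times>\<times> H\<^esub> (k::int) = (x [^]\<^bsub>G\<^esub> k, y [^]\<^bsub>H\<^esub> k)"
proof -
  interpret group G by fact
  interpret H: group H by fact
  interpret D: group "G \<times>\<times> H" by (rule DirProd_group[OF assms(1,2)])
  have "fst \<in> hom (G \<times>\<times> H) G" "snd \<in> hom (G \<times>\<times> H) H"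
    by (auto simp: hom_def)
  then show ?thesis
    using assms hom_int_pow[of fst "G \<times>\<times> H" G "(x, y)" k] hom_int_pow[of snd "G \<times>\<times> H" H "(x, y)" k]
    by (simp add: prod_eq_iff D.is_group)
qed

lemma DirProd_comm_group:
  assumes "comm_group G" "comm_group H"
  shows "comm_group (G \<times>\<times> H)"
proof -
  interpret G: comm_group G by fact
  interpret H: comm_group H by fact
  show ?thesis
    by (rule group.group_comm_groupI[OF DirProd_group])
       (auto simp: G.m_comm H.m_comm G.is_group H.is_group)
qed

text \<open>The trivial subgroup is covered by \<open>n = 0\<close>, since 0 divides only 0.
  Otherwise \<open>n\<close> is the least positive member, and division with remainder shows that it
  divides all others.\<close>

lemma subgroup_int_cyclic:
  assumes "subgroup I integer_group"
  obtains n :: nat where "\<And>k. k \<in> I \<longleftrightarrow> int n dvd k"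
proof (cases "\<exists>m>0. int m \<in> I")
  case False
  have "k = 0" if "k \<in> I" for k
  proof (rule ccontr)
    assume "k \<noteq> 0"
    have "- k \<in> I" using subgroup.m_inv_closed[OF assms that] by simp
    then have "int (nat \<bar>k\<bar>) \<in> I" using that by (cases "k \<ge> 0") auto
    then show False using False \<open>k \<noteq> 0\<close> by (metis zero_less_abs_iff zero_less_nat_eq)
  qed
  moreover have "0 \<in> I" using subgroup.one_closed[OF assms] by simp
  ultimately show ?thesis by (intro that[of 0]) auto
next
  case True
  define n where "n = (LEAST m. m > 0 \<and> int m \<in> I)"
  have n: "n > 0" "int n \<in> I" unfolding n_def by (rule LeastI2_ex; use True in blast)+
  have least: "n \<le> m" if "m > 0" "int m \<in> I" for m
    unfolding n_def by (rule Least_le) (use that in simp)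
  have add: "a + b \<in> I" if "a \<in> I" "b \<in> I" for a b
    using subgroup.m_closed[OF assms that] by simp
  have mult: "int n * j \<in> I" for j
    using group.subgroup_int_pow_closed[OF group_integer_group assms n(2), of j] by (simp add: mult.commute)
  show ?thesis
  proof (rule that)
    fix k show "k \<in> I \<longleftrightarrow> int n dvd k"
    proof
      assume "k \<in> I"
      have "k mod int n = k + int n * (- (k div int n))"
        by (simp add: minus_div_mult_eq_mod[symmetric] algebra_simps)
      then have "k mod int n \<in> I" using add[OF \<open>k \<in> I\<close> mult] by metis
      moreover have "0 \<le> k mod int n" "k mod int n < int n" using n by auto
      ultimately have "k mod int n = 0" using least[of "nat (k mod int n)"] by force
      then show "int n dvd k" by auto
    qed (use mult in auto)
  qed
qed

text \<open>A character on an unspecified subgroup, encoded by its graph. Testing single-valuedness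
  at the identity suffices, because two values at one point differ by a value at the identity.
  Graphs are ordered by inclusion, which suits Zorn's lemma.\<close>

definition single_valued_subgroup :: "('a, 'm) monoid_scheme \<Rightarrow> ('a \<times> complex) set \<Rightarrow> bool" where
  "single_valued_subgroup G \<Gamma> \<longleftrightarrow>
     subgroup \<Gamma> (G \<times>\<times> complex_units) \<and> (\<forall>z. (\<one>\<^bsub>G\<^esub>, z) \<in> \<Gamma> \<longrightarrow> z = 1)"

context comm_group
begin

text \<open>The exponents \<open>k\<close> for which a value at \<open>x [^] k\<close> is already
  prescribed form a subgroup of the integers, say the multiples of \<open>n\<close>. An
  \<open>n\<close>-th root of the value prescribed at \<open>x [^] n\<close> is therefore consistent
  with every constraint on the value at \<open>x\<close>.\<close>

lemma single_valued_subgroup_extend_step: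
  assumes \<Gamma>: "single_valued_subgroup G \<Gamma>" and x: "x \<in> carrier G"
  obtains \<Gamma>' z where "single_valued_subgroup G \<Gamma>'" "\<Gamma> \<subseteq> \<Gamma>'" "(x, z) \<in> \<Gamma>'"
proof -
  let ?D = "G \<times>\<times> complex_units"
  interpret D: comm_group ?D
    by (rule DirProd_comm_group) (auto intro: comm_group_axioms complex_units.comm_group_axioms)
  have sg: "subgroup \<Gamma> ?D" and sv: "\<And>z. (\<one>, z) \<in> \<Gamma> \<Longrightarrow> z = 1"
    using \<Gamma> by (auto simp: single_valued_subgroup_def)
  interpret \<Gamma>: subgroup \<Gamma> ?D by fact
  have mult: "(a \<otimes> b, u * v) \<in> \<Gamma>" if "(a, u) \<in> \<Gamma>" "(b, v) \<in> \<Gamma>" for a b u v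
    using \<Gamma>.m_closed[OF that] by simp
  have memb: "a \<in> carrier G" "u \<noteq> 0" if "(a, u) \<in> \<Gamma>" for a u
    using \<Gamma>.mem_carrier[OF that] by auto
  have inv: "(inv a, inverse u) \<in> \<Gamma>" if "(a, u) \<in> \<Gamma>" for a u
    using \<Gamma>.m_inv_closed[OF that] memb[OF that] by (simp add: inv_DirProd is_group complex_units.is_group)
  define I where "I = {k::int. \<exists>w. (x [^] k, w) \<in> \<Gamma>}"
  have "subgroup I integer_group"
  proof
    show "\<one>\<^bsub>integer_group\<^esub> \<in> I" using \<Gamma>.one_closed by (auto simp: I_def)
  next
    fix a b assume "a \<in> I" "b \<in> I"
    then obtain u v where "(x [^] a, u) \<in> \<Gamma>" "(x [^] b, v) \<in> \<Gamma>" by (auto simp: I_def)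
    from mult[OF this] show "a \<otimes>\<^bsub>integer_group\<^esub> b \<in> I"
      using x by (auto simp: int_pow_mult I_def)
  next
    fix a assume "a \<in> I"
    then obtain u where "(x [^] a, u) \<in> \<Gamma>" by (auto simp: I_def)
    from inv[OF this] show "inv\<^bsub>integer_group\<^esub> a \<in> I"
      using x by (auto simp: int_pow_neg I_def)
  qed simp
  then obtain n :: nat where n: "\<And>k. k \<in> I \<longleftrightarrow> int n dvd k"
    by (rule subgroup_int_cyclic[of I]) blast
  have "int n \<in> I" using n by simp
  then obtain w where w: "(x [^] int n, w) \<in> \<Gamma>" by (auto simp: I_def)
  \<comment> \<open>For \<open>n = 0\<close> no nontrivial power of \<open>x\<close> is constrained,
    and 1 serves as well as any other value.\<close>
  obtain z where z: "z ^ n = w" "z \<noteq> 0"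
  proof (cases "n = 0")
    case True
    then have "w = 1" using w sv by (simp add: int_pow_int)
    then show ?thesis using that[of 1] True by simp
  next
    case False
    then obtain z where "z ^ n = w" using complex_root_exists[of n w] by auto
    moreover have "z \<noteq> 0" using memb(2)[OF w] calculation False by auto
    ultimately show ?thesis using that by blast
  qed
  have xz: "(x, z) \<in> carrier ?D" using x z by simp
  let ?P = "range (\<lambda>k::int. (x, z) [^]\<^bsub>?D\<^esub> k)"
  let ?\<Gamma>' = "?P <#>\<^bsub>?D\<^esub> \<Gamma>"
  have P: "subgroup ?P ?D" by (rule D.subgroup_of_powers[OF xz])
  show ?thesis
  proof (rule that)
    show "single_valued_subgroup G ?\<Gamma>'"
      unfolding single_valued_subgroup_def
    proof (intro conjI allI impI)
      show "subgroup ?\<Gamma>' ?D" by (rule D.mult_subgroups[OF P sg])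
      fix v assume "(\<one>, v) \<in> ?\<Gamma>'"
      then obtain k :: int and h u where hu: "(h, u) \<in> \<Gamma>"
        and eq: "\<one> = x [^] k \<otimes> h" "v = z [^]\<^bsub>complex_units\<^esub> k * u"
        using x z by (auto simp: set_mult_def int_pow_DirProd is_group complex_units.is_group)
      have h: "inv h = x [^] k" by (rule inv_equality) (use eq x memb[OF hu] in auto)
      have iu: "(x [^] k, inverse u) \<in> \<Gamma>" using inv[OF hu] h by simp
      then have "int n dvd k" using n[of k] by (auto simp: I_def)
      then obtain m where m: "k = int n * m" by blast
      have "(x [^] int n, w) [^]\<^bsub>?D\<^esub> m \<in> \<Gamma>"
        by (rule D.subgroup_int_pow_closed[OF sg w])
      moreover have "(x [^] int n) [^] m = x [^] k" using x m by (simp add: int_pow_pow)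
      moreover have "w [^]\<^bsub>complex_units\<^esub> m = z [^]\<^bsub>complex_units\<^esub> k"
        using complex_units.int_pow_pow[of z "int n" m] z m by (simp add: int_pow_int)
      ultimately have "(x [^] k, z [^]\<^bsub>complex_units\<^esub> k) \<in> \<Gamma>"
        using memb[OF w] by (simp add: int_pow_DirProd is_group complex_units.is_group)
      \<comment> \<open>Both \<open>inverse u\<close> and the \<open>k\<close>-th power of
        \<open>z\<close> are now values of the old graph at \<open>x [^] k\<close>, so they
        coincide.\<close>
      from mult[OF inv[OF iu] this] have "(\<one>, u * z [^]\<^bsub>complex_units\<^esub> k) \<in> \<Gamma>"
        using x by simp
      then show "v = 1" using sv eq(2) by (simp add: mult.commute)
    qed
    show "\<Gamma> \<subseteq> ?\<Gamma>'"
    proof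
      fix p assume p: "p \<in> \<Gamma>"
      have "\<one>\<^bsub>?D\<^esub> \<otimes>\<^bsub>?D\<^esub> p \<in> ?\<Gamma>'"
        unfolding set_mult_def using p subgroup.one_closed[OF P] by blast
      then show "p \<in> ?\<Gamma>'" using \<Gamma>.mem_carrier[OF p] D.l_one by metis
    qed
    have "(x, z) [^]\<^bsub>?D\<^esub> (1::int) \<otimes>\<^bsub>?D\<^esub> \<one>\<^bsub>?D\<^esub> \<in> ?\<Gamma>'"
      unfolding set_mult_def using \<Gamma>.one_closed by blast
    then show "(x, z) \<in> ?\<Gamma>'" using xz D.r_one D.int_pow_1 by metis
  qed
qed

text \<open>Zorn's lemma applies because each condition involves at most two members of the graph at
  a time, and two members of the union of a chain lie in a common link.\<close>

lemma single_valued_subgroup_maximal: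
  assumes "single_valued_subgroup G \<Gamma>"
  obtains \<Delta> where "single_valued_subgroup G \<Delta>" "\<Gamma> \<subseteq> \<Delta>"
    "\<And>\<Delta>'. single_valued_subgroup G \<Delta>' \<Longrightarrow> \<Delta> \<subseteq> \<Delta>' \<Longrightarrow> \<Delta>' = \<Delta>"
proof -
  let ?D = "G \<times>\<times> complex_units"
  interpret D: comm_group ?D
    by (rule DirProd_comm_group) (auto intro: comm_group_axioms complex_units.comm_group_axioms)
  let ?A = "{\<Delta>. single_valued_subgroup G \<Delta> \<and> \<Gamma> \<subseteq> \<Delta>}"
  have "\<Union>\<C> \<in> ?A" if "\<C> \<noteq> {}" "subset.chain ?A \<C>" for \<C>
  proof -
    have \<C>: "subgroup \<Delta> ?D" "\<And>z. (\<one>, z) \<in> \<Delta> \<Longrightarrow> z = 1" "\<Gamma> \<subseteq> \<Delta>" if "\<Delta> \<in> \<C>" for \<Delta>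
      using \<open>subset.chain ?A \<C>\<close> that by (auto simp: subset_chain_def single_valued_subgroup_def)
    have "subgroup (\<Union>\<C>) ?D"
    proof
      show "\<Union>\<C> \<subseteq> carrier ?D" using \<C>(1) subgroup.subset by blast
      show "\<one>\<^bsub>?D\<^esub> \<in> \<Union>\<C>" using \<open>\<C> \<noteq> {}\<close> \<C>(1) subgroup.one_closed by blast
      show "inv\<^bsub>?D\<^esub> x \<in> \<Union>\<C>" if "x \<in> \<Union>\<C>" for x
      proof -
        obtain \<Delta> where "\<Delta> \<in> \<C>" "x \<in> \<Delta>" using \<open>x \<in> \<Union>\<C>\<close> by blast
        then show ?thesis using subgroup.m_inv_closed[OF \<C>(1)] by blast
      qed
      fix x y assume "x \<in> \<Union>\<C>" "y \<in> \<Union>\<C>"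
      then obtain \<Delta> \<Delta>' where "\<Delta> \<in> \<C>" "\<Delta>' \<in> \<C>" "x \<in> \<Delta>" "y \<in> \<Delta>'" by blast
      moreover then have "\<Delta> \<subseteq> \<Delta>' \<or> \<Delta>' \<subseteq> \<Delta>"
        using \<open>subset.chain ?A \<C>\<close> unfolding subset_chain_def by blast
      ultimately show "x \<otimes>\<^bsub>?D\<^esub> y \<in> \<Union>\<C>" using subgroup.m_closed[OF \<C>(1)] by blast
    qed
    moreover have "\<Gamma> \<subseteq> \<Union>\<C>" using \<C>(3) \<open>\<C> \<noteq> {}\<close> by blast
    moreover have "z = 1" if "(\<one>, z) \<in> \<Union>\<C>" for z using that \<C>(2) by blast
    ultimately show ?thesis by (simp add: single_valued_subgroup_def)
  qed
  moreover have "?A \<noteq> {}" using assms by blast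
  ultimately have "\<exists>\<Delta>\<in>?A. \<forall>\<Delta>'\<in>?A. \<Delta> \<subseteq> \<Delta>' \<longrightarrow> \<Delta>' = \<Delta>"
    by (rule subset_Zorn_nonempty[rotated])
  then obtain \<Delta> where \<Delta>: "\<Delta> \<in> ?A" "\<forall>\<Delta>'\<in>?A. \<Delta> \<subseteq> \<Delta>' \<longrightarrow> \<Delta>' = \<Delta>"
    by (rule bexE)
  show ?thesis
  proof (rule that[of \<Delta>])
    fix \<Delta>' assume "single_valued_subgroup G \<Delta>'" "\<Delta> \<subseteq> \<Delta>'"
    then show "\<Delta>' = \<Delta>" using \<Delta> by auto
  qed (use \<Delta>(1) in auto)
qed

text \<open>A maximal graph is defined everywhere, as the extension step would otherwise enlarge
  it.\<close>

lemma character_extending_subgroup: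
  assumes "single_valued_subgroup G \<Gamma>"
  obtains \<chi> where "\<chi> \<in> hom G complex_units" "\<And>x z. (x, z) \<in> \<Gamma> \<Longrightarrow> \<chi> x = z"
proof -
  obtain \<Delta> where \<Delta>: "single_valued_subgroup G \<Delta>" "\<Gamma> \<subseteq> \<Delta>"
    and max: "\<And>\<Delta>'. single_valued_subgroup G \<Delta>' \<Longrightarrow> \<Delta> \<subseteq> \<Delta>' \<Longrightarrow> \<Delta>' = \<Delta>"
    using single_valued_subgroup_maximal[OF assms] by metis
  have total: "\<exists>z. (x, z) \<in> \<Delta>" if "x \<in> carrier G" for x
    using single_valued_subgroup_extend_step[OF \<Delta>(1) that] max by metis
  interpret \<Delta>: subgroup \<Delta> "G \<times>\<times> complex_units"
    using \<Delta>(1) by (simp add: single_valued_subgroup_def)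
  have unique: "u = v" if "(x, u) \<in> \<Delta>" "(x, v) \<in> \<Delta>" for x u v
  proof -
    have "x \<in> carrier G" "u \<noteq> 0" "v \<noteq> 0" using that \<Delta>.mem_carrier by force+
    moreover from this have "(\<one>, u * inverse v) \<in> \<Delta>"
      using \<Delta>.m_closed[OF that(1) \<Delta>.m_inv_closed[OF that(2)]]
      by (simp add: inv_DirProd is_group complex_units.is_group)
    then have "u * inverse v = 1" using \<Delta>(1) by (auto simp: single_valued_subgroup_def)
    ultimately show ?thesis by (simp add: field_simps)
  qed
  define \<chi> where "\<chi> x = (THE z. (x, z) \<in> \<Delta>)" for x
  have \<chi>_eq: "\<chi> x = z" if "(x, z) \<in> \<Delta>" for x z
    unfolding \<chi>_def using that unique by blast
  have \<chi>: "(x, \<chi> x) \<in> \<Delta>" if "x \<in> carrier G" for x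
    using total[OF that] \<chi>_eq by metis
  show ?thesis
  proof
    show "\<chi> \<in> hom G complex_units"
    proof (rule homI)
      fix x y assume "x \<in> carrier G" "y \<in> carrier G"
      then show "\<chi> (x \<otimes> y) = \<chi> x \<otimes>\<^bsub>complex_units\<^esub> \<chi> y"
        using \<Delta>.m_closed[OF \<chi> \<chi>, of x y] by (intro \<chi>_eq) simp
    qed (use \<chi> \<Delta>.mem_carrier in force)
  qed (use \<Delta>(2) \<chi>_eq in blast)
qed

text \<open>The graph of \<open>\<psi>\<close> times \<open>K \<times> {1}\<close> is a subgroup,
  and it is single-valued precisely because \<open>\<psi>\<close> is trivial on
  \<open>H \<inter> K\<close>. This form serves plain extension (trivial \<open>K\<close>),
  extension across a direct factor, and extension from \<open>R\<close> by 1 on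
  \<open>F^2\<close>.\<close>

lemma character_extending_trivially:
  assumes H: "subgroup H G" and K: "subgroup K G"
    and \<psi>: "\<And>x y. x \<in> H \<Longrightarrow> y \<in> H \<Longrightarrow> \<psi> (x \<otimes> y) = \<psi> x * \<psi> y" "\<And>x. x \<in> H \<Longrightarrow> \<psi> x \<noteq> (0 :: complex)"
    and trivial: "\<And>x. x \<in> H \<Longrightarrow> x \<in> K \<Longrightarrow> \<psi> x = 1"
  obtains \<chi> where "\<chi> \<in> hom G complex_units" "\<And>x. x \<in> H \<Longrightarrow> \<chi> x = \<psi> x" "\<And>x. x \<in> K \<Longrightarrow> \<chi> x = 1"
proof -
  let ?D = "G \<times>\<times> complex_units"
  interpret H: subgroup H G by fact
  interpret K: subgroup K G by fact
  interpret D: comm_group ?D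
    by (rule DirProd_comm_group) (auto intro: comm_group_axioms complex_units.comm_group_axioms)
  have one: "\<psi> \<one> = 1" using trivial by simp
  have inv: "\<psi> (inv x) = inverse (\<psi> x)" if "x \<in> H" for x
    using \<psi>(1)[of "inv x" x] that H.mem_carrier[OF that] one \<psi>(2)[OF that]
    by (simp add: field_simps)
  let ?\<Gamma> = "((\<lambda>x. (x, \<psi> x)) ` H) <#>\<^bsub>?D\<^esub> (K \<times> {1})"
  have "subgroup ((\<lambda>x. (x, \<psi> x)) ` H) ?D"
    by unfold_locales (auto simp: one \<psi> inv inv_DirProd is_group complex_units.is_group image_iff)
  moreover have "subgroup (K \<times> {1}) ?D"
    by unfold_locales (auto simp: inv_DirProd is_group complex_units.is_group)
  ultimately have "subgroup ?\<Gamma> ?D" by (rule D.mult_subgroups)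
  moreover have "z = 1" if z: "(\<one>, z) \<in> ?\<Gamma>" for z
  proof -
    obtain h k where hk: "h \<in> H" "k \<in> K" "\<one> = h \<otimes> k" "z = \<psi> h"
      using z by (auto simp: set_mult_def)
    then have "h = inv k" by (metis H.mem_carrier K.mem_carrier inv_equality)
    then show ?thesis using hk trivial by auto
  qed
  ultimately have "single_valued_subgroup G ?\<Gamma>" by (simp add: single_valued_subgroup_def)
  then obtain \<chi> where \<chi>: "\<chi> \<in> hom G complex_units" "\<And>x z. (x, z) \<in> ?\<Gamma> \<Longrightarrow> \<chi> x = z"
    by (rule character_extending_subgroup) metis
  have mem: "p \<otimes>\<^bsub>?D\<^esub> q \<in> A <#>\<^bsub>?D\<^esub> B" if "p \<in> A" "q \<in> B" for p q A B
    using that by (auto simp: set_mult_def)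
  show ?thesis
  proof
    fix x assume "x \<in> H"
    then have "(x, \<psi> x) \<otimes>\<^bsub>?D\<^esub> (\<one>, 1) \<in> ?\<Gamma>"
      using K.one_closed by (intro mem imageI) auto
    then show "\<chi> x = \<psi> x" using \<chi>(2) H.mem_carrier[OF \<open>x \<in> H\<close>] by simp
  next
    fix x assume "x \<in> K"
    then have "(\<one>, \<psi> \<one>) \<otimes>\<^bsub>?D\<^esub> (x, 1) \<in> ?\<Gamma>"
      using H.one_closed by (intro mem imageI) auto
    then show "\<chi> x = 1" using \<chi>(2) K.mem_carrier[OF \<open>x \<in> K\<close>] one by simp
  qed (rule \<chi>(1))
qed

end

section \<open>Self-duality of finite abelian groups\<close>

definition character_group :: "('a, 'm) monoid_scheme \<Rightarrow> ('a \<Rightarrow> complex) monoid" where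
  "character_group G = (product_group (carrier G) (\<lambda>_. complex_units))
     \<lparr>carrier := hom G complex_units \<inter> extensional (carrier G)\<rparr>"

lemma character_group_simps:
  "\<chi> \<in> carrier (character_group G) \<longleftrightarrow> \<chi> \<in> hom G complex_units \<and> \<chi> \<in> extensional (carrier G)"
  "\<chi> \<otimes>\<^bsub>character_group G\<^esub> \<psi> = (\<lambda>x\<in>carrier G. \<chi> x * \<psi> x)"
  "\<one>\<^bsub>character_group G\<^esub> = (\<lambda>x\<in>carrier G. 1)"
  by (simp_all add: character_group_def)

lemma hom_complex_units_iff:
  "\<chi> \<in> hom G complex_units \<longleftrightarrow> (\<forall>x\<in>carrier G. \<chi> x \<noteq> 0) \<and>
     (\<forall>x\<in>carrier G. \<forall>y\<in>carrier G. \<chi> (x \<otimes>\<^bsub>G\<^esub> y) = \<chi> x * \<chi> y)"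
  by (auto simp: hom_def)

lemma comm_group_character_group:
  assumes "monoid G"
  shows "comm_group (character_group G)"
proof -
  interpret monoid G by fact
  show ?thesis
  proof (rule comm_groupI)
    fix \<chi> assume "\<chi> \<in> carrier (character_group G)"
    then show "\<exists>\<psi>\<in>carrier (character_group G). \<psi> \<otimes>\<^bsub>character_group G\<^esub> \<chi> = \<one>\<^bsub>character_group G\<^esub>"
      by (intro bexI[of _ "\<lambda>x\<in>carrier G. inverse (\<chi> x)"])
        (auto simp: character_group_simps hom_complex_units_iff fun_eq_iff)
  qed (auto simp: character_group_simps hom_complex_units_iff fun_eq_iff extensional_def mult_ac)
qed

section \<open>Elements of maximal order and cyclic direct factors\<close>

text \<open>A power of \<open>a \<otimes> b\<close> with exponent divisible by \<open>ord b\<close>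
  is a power of \<open>a\<close> alone. Hence \<open>ord a\<close> divides
  \<open>ord (a \<otimes> b) * ord b\<close>, and coprimality removes the second factor; the roles
  are then exchanged.\<close>

lemma (in comm_group) ord_mult_coprime:
  assumes a: "a \<in> carrier G" and b: "b \<in> carrier G" and coprime: "coprime (ord a) (ord b)"
  shows "ord (a \<otimes> b) = ord a * ord b"
proof (rule dvd_antisym)
  show "ord (a \<otimes> b) dvd ord a * ord b" by (rule abelian_ord_mul_divides[OF a b])
  let ?m = "ord (a \<otimes> b)"
  have ab: "(a [^] k) \<otimes> (b [^] k) = \<one>" if "?m dvd k" for k :: nat
    using that a b pow_eq_id[of "a \<otimes> b" k] by (simp add: nat_pow_distrib)
  have "a [^] (?m * ord b) = \<one>" 
    using ab[of "?m * ord b"] a b by (simp add: pow_eq_id[THEN iffD2])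
  then have "ord a dvd ?m" using a coprime by (simp add: pow_eq_id coprime_dvd_mult_left_iff)
  moreover have "b [^] (?m * ord a) = \<one>"
    using ab[of "?m * ord a"] a b by (simp add: pow_eq_id[THEN iffD2])
  then have "ord b dvd ?m" using b coprime
    by (simp add: pow_eq_id coprime_dvd_mult_left_iff coprime_commute)
  ultimately show "ord a * ord b dvd ?m" using coprime by (simp add: divides_mult)
qed

text \<open>An element \<open>a\<close> of maximal order works. If a prime \<open>p\<close> occurred
  in \<open>ord b\<close> to a higher power \<open>k\<close> than its power \<open>j\<close> in
  \<open>ord a\<close>, then the \<open>p\<close>-free part of \<open>ord a\<close> and
  \<open>p ^ k\<close> would be coprime orders of suitable powers of \<open>a\<close> and
  \<open>b\<close>, and their product would be an order exceeding the maximum.\<close>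

lemma (in comm_group) exponent_element:
  assumes fin: "finite (carrier G)"
  obtains a where "a \<in> carrier G" "\<And>b. b \<in> carrier G \<Longrightarrow> b [^] ord a = \<one>"
proof -
  have pos: "ord a > 0" if "a \<in> carrier G" for a
    using ord_ge_1[OF fin that] by simp
  have "finite (ord ` carrier G)" "ord ` carrier G \<noteq> {}" using fin by auto
  then have "Max (ord ` carrier G) \<in> ord ` carrier G" by (rule Max_in)
  then obtain a where a: "a \<in> carrier G" "ord a = Max (ord ` carrier G)" by auto
  have max: "ord b \<le> ord a" if "b \<in> carrier G" for b
    using fin that a by simp
  show ?thesis
  proof (rule that[OF a(1)])
    fix b assume b: "b \<in> carrier G"
    have "ord b dvd ord a"
    proof (rule multiplicity_le_imp_dvd)
      show "ord b \<noteq> 0" using pos[OF b] by simp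
      fix p :: nat assume p: "Factorial_Ring.prime p"
      define j k where "j = multiplicity p (ord a)" and "k = multiplicity p (ord b)"
      obtain m where m: "ord a = p ^ j * m" "\<not> p dvd m"
        using multiplicity_decompose'[of "ord a" p] pos[OF a(1)] p unfolding j_def
        by (metis gr_implies_not0 not_prime_unit)
      have "p ^ k dvd ord b" unfolding k_def by (rule multiplicity_dvd)
      then obtain l where l: "ord b = p ^ k * l" by blast
      have l0: "l > 0" using l pos[OF b] by (cases l) auto
      have p0: "p > 0" using p prime_gt_0_nat by blast
      have "ord (a [^] (p ^ j)) = m" using m p0 a(1) by (subst ord_pow) auto
      moreover have "ord (b [^] l) = p ^ k" using l l0 b by (subst ord_pow) auto
      moreover have "coprime m (p ^ k)"
        using prime_imp_coprime[OF p m(2)] by (simp add: coprime_commute)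
      ultimately have "ord ((a [^] (p ^ j)) \<otimes> (b [^] l)) = m * p ^ k"
        using a(1) b by (subst ord_mult_coprime) auto
      then have "m * p ^ k \<le> p ^ j * m" using max[of "(a [^] (p ^ j)) \<otimes> (b [^] l)"] a b m by simp
      then have "p ^ k \<le> p ^ j" using m pos[OF a(1)] by (simp add: mult.commute)
      then have "k \<le> j" by (rule power_le_imp_le_exp[OF prime_gt_1_nat[OF p]])
      then show "multiplicity p (ord b) \<le> multiplicity p (ord a)" by (simp add: j_def k_def)
    qed
    then show "b [^] ord a = \<one>" using b by (simp add: pow_eq_id)
  qed
qed

lemma root_of_unity_generator:
  assumes "n > 0"
  obtains \<zeta> :: complex where "\<And>k. \<zeta> ^ k = 1 \<longleftrightarrow> n dvd k" "\<And>w. w ^ n = 1 \<Longrightarrow> \<exists>k. w = \<zeta> ^ k"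
proof
  let ?z = "cis (2 * pi / real n)"
  have pow: "?z ^ k = cis (2 * pi * real k / real n)" for k
    by (simp add: DeMoivre mult.commute)
  have bij: "bij_betw (\<lambda>k. cis (2 * pi * real k / real n)) {..<n} {z. z ^ n = 1}"
    by (rule bij_betw_roots_unity[OF assms])
  show ex: "\<exists>k. w = ?z ^ k" if "w ^ n = 1" for w
    using bij_betw_imp_surj_on[OF bij] that unfolding pow by blast
  have n1: "?z ^ n = 1" using assms by (simp add: pow)
  show "?z ^ k = 1 \<longleftrightarrow> n dvd k" for k
  proof
    assume "?z ^ k = 1"
    moreover have "?z ^ k = ?z ^ (k mod n)"
      using n1 by (metis mult.left_neutral mult.commute mult_div_mod_eq power_add power_mult power_one)
    ultimately have "?z ^ (k mod n) = ?z ^ 0" by simp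
    then have "k mod n = 0"
      using bij_betw_imp_inj_on[OF bij] assms unfolding pow inj_on_def by (metis lessThan_iff mod_less_divisor)
    then show "n dvd k" by auto
  next
    assume "n dvd k"
    then show "?z ^ k = 1" using n1 by (auto simp: power_mult)
  qed
qed


text \<open>Sending \<open>a\<close> to a root of unity of the same order gives a single-valued
  graph, which extends to the whole group. As \<open>ord a\<close> annihilates the group, every
  value of the extension is an \<open>ord a\<close>-th root of unity and is thus already attained on
  the powers of \<open>a\<close>.\<close>

lemma (in comm_group) character_faithful_on_powers:
  assumes a: "a \<in> carrier G" and pos: "ord a > 0"
    and exp: "\<And>b. b \<in> carrier G \<Longrightarrow> b [^] ord a = \<one>"
  obtains \<chi> where "\<chi> \<in> hom G complex_units" "\<chi> ` range (\<lambda>k::int. a [^] k) = {w. w ^ ord a = 1}"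
    "\<And>x. x \<in> range (\<lambda>k::int. a [^] k) \<Longrightarrow> \<chi> x = 1 \<Longrightarrow> x = \<one>"
    "\<And>b. b \<in> carrier G \<Longrightarrow> \<chi> b ^ ord a = 1"
proof -
  let ?n = "ord a" and ?D = "G \<times>\<times> complex_units"
  interpret D: comm_group ?D
    by (rule DirProd_comm_group) (auto intro: comm_group_axioms complex_units.comm_group_axioms)
  obtain \<zeta> :: complex where \<zeta>: "\<And>k. \<zeta> ^ k = 1 \<longleftrightarrow> ?n dvd k" "\<And>w. w ^ ?n = 1 \<Longrightarrow> \<exists>k. w = \<zeta> ^ k"
    by (rule root_of_unity_generator[OF pos]) metis
  have "\<zeta> \<noteq> 0" using \<zeta>(1)[of ?n] pos by (metis dvd_refl power_0_left zero_neq_one less_irrefl)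
  have \<zeta>c: "\<zeta> \<in> carrier complex_units" using \<open>\<zeta> \<noteq> 0\<close> by simp
  have a\<zeta>: "(a, \<zeta>) \<in> carrier ?D" using a \<zeta>c by simp
  have ord_\<zeta>: "group.ord complex_units \<zeta> = ?n"
    using \<zeta>(1) complex_units.ord_unique[OF \<zeta>c] by simp
  let ?\<Gamma> = "range (\<lambda>k::int. (a, \<zeta>) [^]\<^bsub>?D\<^esub> k)"
  have pow: "(a, \<zeta>) [^]\<^bsub>?D\<^esub> (k::int) = (a [^] k, \<zeta> [^]\<^bsub>complex_units\<^esub> k)" for k
    by (rule int_pow_DirProd[OF is_group complex_units.is_group a \<zeta>c])
  have pow1: "\<zeta> [^]\<^bsub>complex_units\<^esub> (k::int) = 1 \<longleftrightarrow> a [^] k = \<one>" for k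
    using complex_units.int_pow_eq_id[OF \<zeta>c, of k] int_pow_eq_id[OF a, of k] ord_\<zeta> by simp
  have "z = 1" if z: "(\<one>, z) \<in> ?\<Gamma>" for z
  proof -
    obtain k :: int where "(\<one>, z) = (a [^] k, \<zeta> [^]\<^bsub>complex_units\<^esub> k)"
      using z[unfolded pow] by (rule imageE)
    then show ?thesis using pow1[of k] by (simp only: prod.inject)
  qed
  then have "single_valued_subgroup G ?\<Gamma>"
    unfolding single_valued_subgroup_def
    using D.subgroup_of_powers[OF a\<zeta>] by (intro conjI allI impI)
  then obtain \<chi> where \<chi>: "\<chi> \<in> hom G complex_units" "\<And>x z. (x, z) \<in> ?\<Gamma> \<Longrightarrow> \<chi> x = z"
    by (rule character_extending_subgroup) metis
  have \<chi>a: "\<chi> (a [^] k) = \<zeta> [^]\<^bsub>complex_units\<^esub> k" for k :: int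
    using pow[of k] by (intro \<chi>(2)) (metis rangeI)
  have \<chi>n: "\<chi> b ^ ?n = 1" if "b \<in> carrier G" for b
  proof -
    interpret \<chi>: group_hom G complex_units \<chi>
      using \<chi>(1) by unfold_locales
    show ?thesis using \<chi>.hom_nat_pow[OF that, of ?n] exp[OF that] by simp
  qed
  show ?thesis
  proof
    show "\<chi> ` range (\<lambda>k::int. a [^] k) = {w. w ^ ?n = 1}"
    proof (intro equalityI subsetI)
      fix w :: complex assume "w \<in> {w. w ^ ?n = 1}"
      then obtain k where "w = \<zeta> ^ k" using \<zeta>(2) by auto
      then have "w = \<chi> (a [^] int k)" using \<chi>a[of "int k"] by (simp add: int_pow_int)
      then show "w \<in> \<chi> ` range (\<lambda>k::int. a [^] k)" by blast
    qed (use \<chi>n a in auto)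
    fix x assume "x \<in> range (\<lambda>k::int. a [^] k)" "\<chi> x = 1"
    then show "x = \<one>" using \<chi>a pow1 by auto
  qed (use \<chi>(1) \<chi>n in auto)
qed

text \<open>\<open>G\<close> is the internal direct product of the kernel \<open>K\<close> and
  \<open>C\<close>: equality of the images gives \<open>G = K C\<close>, faithfulness gives trivial
  intersection. Duality respects this splitting, so self-duality of both factors passes to
  \<open>G\<close>.\<close>

lemma (in comm_group) is_iso_character_group_step:
  assumes \<chi>: "\<chi> \<in> hom G complex_units" and C: "subgroup C G"
    and inj: "\<And>x. x \<in> C \<Longrightarrow> \<chi> x = 1 \<Longrightarrow> x = \<one>"
    and surj: "\<chi> ` C = \<chi> ` carrier G"
  defines "K \<equiv> kernel G complex_units \<chi>"
  assumes K: "G\<lparr>carrier := K\<rparr> \<cong> character_group (G\<lparr>carrier := K\<rparr>)"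
    and self_dual: "G\<lparr>carrier := C\<rparr> \<cong> character_group (G\<lparr>carrier := C\<rparr>)"
  shows "G \<cong> character_group G"
proof -
  interpret \<chi>: group_hom G complex_units \<chi> using \<chi> by unfold_locales
  interpret C: subgroup C G by fact
  have sK: "subgroup K G" unfolding K_def by (rule \<chi>.subgroup_kernel)
  interpret K: subgroup K G by (rule sK)
  have kerD: "\<chi> x = 1" if "x \<in> K" for x using that unfolding K_def kernel_def by simp
  have KC: "x = \<one>" if "x \<in> K" "x \<in> C" for x
    using that kerD by (intro inj)
  have decomp: "\<exists>k\<in>K. \<exists>c\<in>C. x = k \<otimes> c" if x: "x \<in> carrier G" for x
  proof -
    have "\<chi> x \<in> \<chi> ` C" using surj x by blast
    then obtain c where c: "c \<in> C" "\<chi> c = \<chi> x" by force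
    have "x \<otimes> inv c \<in> K"
      unfolding K_def kernel_def using x C.mem_carrier[OF c(1)] c(2) \<chi>.hom_closed[OF x] by simp
    moreover have "x = (x \<otimes> inv c) \<otimes> c" using x C.mem_carrier[OF c(1)] by (simp add: m_assoc)
    ultimately show ?thesis using c(1) by blast
  qed
  let ?K = "G\<lparr>carrier := K\<rparr>" and ?C = "G\<lparr>carrier := C\<rparr>"
  have gK: "group ?K" and gC: "group ?C" using K.subgroup_is_group C.subgroup_is_group is_group by auto
  have "(\<lambda>(x, y). x \<otimes> y) \<in> iso (?K \<times>\<times> ?C) G"
  proof (rule isoI)
    show "(\<lambda>(x, y). x \<otimes> y) \<in> hom (?K \<times>\<times> ?C) G"
      by (rule homI) (auto simp: K.mem_carrier C.mem_carrier m_ac)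
    have "k = k' \<and> c = c'"
      if "k \<in> K" "k' \<in> K" "c \<in> C" "c' \<in> C" and eq: "k \<otimes> c = k' \<otimes> c'" for k k' c c'
    proof -
      note mem = that(1,2)[THEN K.mem_carrier] that(3,4)[THEN C.mem_carrier]
      have "\<chi> (k \<otimes> c) = \<chi> (k' \<otimes> c')" using eq by simp
      then have "\<chi> c = \<chi> c'" using kerD[OF that(1)] kerD[OF that(2)] mem by simp
      then have "\<chi> (c \<otimes> inv c') = 1" using mem \<chi>.hom_closed[OF mem(4)] by simp
      then have "c \<otimes> inv c' = \<one>" by (intro inj C.m_closed C.m_inv_closed that)
      then have "c = c'" using mem by (metis inv_closed inv_equality inv_inv)
      then show ?thesis using eq mem by simp
    qed
    then show "bij_betw (\<lambda>(x, y). x \<otimes> y) (carrier (?K \<times>\<times> ?C)) (carrier G)"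
      unfolding bij_betw_def inj_on_def using decomp
      by (auto simp: image_iff K.mem_carrier C.mem_carrier Bex_def)
  qed
  then have split: "?K \<times>\<times> ?C \<cong> G" by (auto simp: is_iso_def)
  let ?r = "\<lambda>\<psi>. (restrict \<psi> K, restrict \<psi> C)"
  have "?r \<in> iso (character_group G) (character_group ?K \<times>\<times> character_group ?C)"
  proof (rule isoI)
    show "?r \<in> hom (character_group G) (character_group ?K \<times>\<times> character_group ?C)"
      by (rule homI) (auto simp: character_group_simps hom_complex_units_iff fun_eq_iff K.mem_carrier C.mem_carrier)
    show "bij_betw ?r (carrier (character_group G)) (carrier (character_group ?K \<times>\<times> character_group ?C))"
      unfolding bij_betw_def
    proof (intro conjI inj_onI equalityI subsetI)
      fix \<phi> \<psi> assume h: "\<phi> \<in> carrier (character_group G)" "\<psi> \<in> carrier (character_group G)" "?r \<phi> = ?r \<psi>"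
      have eq: "\<phi> k = \<psi> k" "\<phi> c = \<psi> c" if "k \<in> K" "c \<in> C" for k c
        using h(3) that by (metis prod.inject restrict_apply')+
      show "\<phi> = \<psi>"
      proof (rule extensionalityI)
        fix x assume "x \<in> carrier G"
        then obtain k c where "k \<in> K" "c \<in> C" "x = k \<otimes> c" using decomp by metis
        then show "\<phi> x = \<psi> x" using h(1,2) eq K.mem_carrier C.mem_carrier
          by (simp add: character_group_simps hom_complex_units_iff)
      qed (use h in \<open>auto simp: character_group_simps\<close>)
    next
      fix p assume "p \<in> ?r ` carrier (character_group G)"
      then show "p \<in> carrier (character_group ?K \<times>\<times> character_group ?C)"
        by (auto simp: character_group_simps hom_complex_units_iff K.mem_carrier C.mem_carrier)
    next
      fix p assume "p \<in> carrier (character_group ?K \<times>\<times> character_group ?C)"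
      then obtain \<phi> \<psi> where p: "p = (\<phi>, \<psi>)" and \<phi>: "\<phi> \<in> carrier (character_group ?K)"
        and \<psi>: "\<psi> \<in> carrier (character_group ?C)" by auto
      obtain \<phi>' where \<phi>': "\<phi>' \<in> hom G complex_units" "\<And>x. x \<in> K \<Longrightarrow> \<phi>' x = \<phi> x" "\<And>x. x \<in> C \<Longrightarrow> \<phi>' x = 1"
        using \<phi> character_extending_trivially[OF sK C, of \<phi>] KC hom_one[of \<phi> ?K complex_units]
        by (auto simp: character_group_simps hom_complex_units_iff gK complex_units.is_group)
      obtain \<psi>' where \<psi>': "\<psi>' \<in> hom G complex_units" "\<And>x. x \<in> C \<Longrightarrow> \<psi>' x = \<psi> x" "\<And>x. x \<in> K \<Longrightarrow> \<psi>' x = 1"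
        using \<psi> character_extending_trivially[OF C sK, of \<psi>] KC hom_one[of \<psi> ?C complex_units]
        by (auto simp: character_group_simps hom_complex_units_iff gC complex_units.is_group)
      \<comment> \<open>Each factor's character was extended by 1 to the other factor, so on either
        factor only one of the two extensions contributes to the product.\<close>
      let ?w = "\<lambda>x\<in>carrier G. \<phi>' x * \<psi>' x"
      have "?w \<in> carrier (character_group G)" using \<phi>'(1) \<psi>'(1)
        by (auto simp: character_group_simps hom_complex_units_iff)
      moreover have "restrict ?w K = \<phi>"
        by (rule extensionalityI[of _ K])
          (use \<phi> \<phi>'(2) \<psi>'(3) K.mem_carrier in \<open>simp_all add: character_group_simps del: restrict_restrict\<close>)
      moreover have "restrict ?w C = \<psi>"
        by (rule extensionalityI[of _ C])
          (use \<psi> \<phi>'(3) \<psi>'(2) C.mem_carrier in \<open>simp_all add: character_group_simps del: restrict_restrict\<close>)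
      moreover from calculation(2,3) have "p = ?r ?w" unfolding p by simp
      ultimately show "p \<in> ?r ` carrier (character_group G)" by (intro image_eqI[of _ _ ?w]) simp_all
    qed
  qed
  then have dual: "character_group G \<cong> character_group ?K \<times>\<times> character_group ?C" by (auto simp: is_iso_def)
  have "G \<cong> ?K \<times>\<times> ?C" using split DirProd_group[OF gK gC] group.iso_sym by blast
  also have "?K \<times>\<times> ?C \<cong> character_group ?K \<times>\<times> character_group ?C"
    by (rule group.DirProd_iso_trans[OF gK K self_dual])
  also have "\<dots> \<cong> character_group G"
    using dual comm_group_character_group[OF monoid_axioms] comm_group.axioms(2) group.iso_sym by blast
  finally show ?thesis .
qed

text \<open>Both sides are identified with the group of \<open>ord a\<close>-th roots of unity: the
  cyclic group through \<open>\<chi>\<close>, its dual through evaluation at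
  \<open>a\<close>.\<close>

lemma (in comm_group) is_iso_character_group_powers:
  assumes a: "a \<in> carrier G" and \<chi>: "\<chi> \<in> hom G complex_units"
    and surj: "\<chi> ` range (\<lambda>k::int. a [^] k) = {w. w ^ ord a = 1}"
    and inj: "\<And>x. x \<in> range (\<lambda>k::int. a [^] k) \<Longrightarrow> \<chi> x = 1 \<Longrightarrow> x = \<one>"
  shows "G\<lparr>carrier := range (\<lambda>k::int. a [^] k)\<rparr> \<cong>
    character_group (G\<lparr>carrier := range (\<lambda>k::int. a [^] k)\<rparr>)"
proof -
  let ?A = "range (\<lambda>k::int. a [^] k)"
  let ?C = "G\<lparr>carrier := ?A\<rparr>" and ?M = "complex_units\<lparr>carrier := {w. w ^ ord a = 1}\<rparr>"
  interpret \<chi>: group_hom G complex_units \<chi> using \<chi> by unfold_locales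
  have sA: "subgroup ?A G" by (rule subgroup_of_powers[OF a])
  interpret A: subgroup ?A G by fact
  have gC: "group ?C" by (rule A.subgroup_is_group[OF is_group])
  have aA: "a \<in> ?A" by (rule image_eqI[of _ _ 1]) (use a in auto)
  have \<chi>_hom: "\<chi> (x \<otimes> y) = \<chi> x * \<chi> y" "\<chi> x \<noteq> 0" if "x \<in> ?A" "y \<in> ?A" for x y
    using that[THEN A.mem_carrier] \<chi>.hom_closed by auto
  have "\<chi> \<in> iso ?C ?M"
  proof (rule isoI)
    show "\<chi> \<in> hom ?C ?M"
    proof (rule homI)
      fix x assume "x \<in> carrier ?C"
      then show "\<chi> x \<in> carrier ?M" using surj by auto
    qed (use \<chi>_hom in simp)
    have "inj_on \<chi> ?A"
    proof (rule inj_onI)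
      fix x y assume xy: "x \<in> ?A" "y \<in> ?A" "\<chi> x = \<chi> y"
      then have "\<chi> (x \<otimes> inv y) = 1"
        using \<chi>_hom[OF xy(2) xy(2)] xy(1,2)[THEN A.mem_carrier] by (simp add: \<chi>.hom_inv)
      then have "x \<otimes> inv y = \<one>" by (intro inj A.m_closed A.m_inv_closed xy)
      then show "x = y" using xy(1,2)[THEN A.mem_carrier]
        by (metis inv_closed inv_equality inv_inv)
    qed
    then show "bij_betw \<chi> (carrier ?C) (carrier ?M)"
      using surj by (simp add: bij_betw_def)
  qed
  then have iso1: "?C \<cong> ?M" by (auto simp: is_iso_def)
  have powC: "x [^]\<^bsub>?C\<^esub> (k::int) = x [^] k" if "x \<in> ?A" for x k
    using int_pow_consistent[OF sA that] by simp
  let ?e = "\<lambda>\<psi>. \<psi> a"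
  have pow_eq: "\<psi> (a [^] k) = \<psi> a [^]\<^bsub>complex_units\<^esub> k"
    if "\<psi> \<in> carrier (character_group ?C)" for \<psi> and k :: int
    using that hom_int_pow[of \<psi> ?C complex_units a k] aA powC[OF aA]
    by (simp add: character_group_simps gC complex_units.is_group)
  have "?e \<in> iso (character_group ?C) ?M"
  proof (rule isoI)
    show "?e \<in> hom (character_group ?C) ?M"
    proof (rule homI)
      fix \<psi> assume \<psi>: "\<psi> \<in> carrier (character_group ?C)"
      have "\<psi> (a [^] (0::int)) = 1" using pow_eq[OF \<psi>, of 0] by simp
      moreover have "a [^] int (ord a) = \<one>" using a by (simp add: int_pow_int)
      ultimately show "?e \<psi> \<in> carrier ?M" using pow_eq[OF \<psi>, of "int (ord a)"]
        by (simp add: int_pow_int)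
    next
      fix \<phi> \<psi>
      show "?e (\<phi> \<otimes>\<^bsub>character_group ?C\<^esub> \<psi>) = ?e \<phi> \<otimes>\<^bsub>?M\<^esub> ?e \<psi>"
        using aA by (simp add: character_group_simps)
    qed
    show "bij_betw ?e (carrier (character_group ?C)) (carrier ?M)"
      unfolding bij_betw_def
    proof (intro conjI inj_onI equalityI subsetI)
      fix \<phi> \<psi> assume h: "\<phi> \<in> carrier (character_group ?C)" "\<psi> \<in> carrier (character_group ?C)" "\<phi> a = \<psi> a"
      show "\<phi> = \<psi>"
      proof (rule extensionalityI)
        fix x assume "x \<in> ?A"
        then show "\<phi> x = \<psi> x" using pow_eq[OF h(1)] pow_eq[OF h(2)] h(3) by auto
      qed (use h in \<open>simp_all add: character_group_simps\<close>)
    next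
      fix w assume "w \<in> ?e ` carrier (character_group ?C)"
      then show "w \<in> carrier ?M" using \<open>?e \<in> hom (character_group ?C) ?M\<close> by (auto simp: hom_def)
    next
      fix w assume "w \<in> carrier ?M"
      then have "w \<in> \<chi> ` ?A" using surj by simp
      then obtain k :: int where k: "w = \<chi> (a [^] k)" by blast
      \<comment> \<open>The root \<open>w\<close> is the \<open>k\<close>-th power of
        \<open>\<chi> a\<close>, hence the value at \<open>a\<close> of the \<open>k\<close>-th
        power of the character \<open>\<chi>\<close>.\<close>
      let ?\<psi> = "\<lambda>x\<in>?A. \<chi> x [^]\<^bsub>complex_units\<^esub> k"
      have "\<chi> x [^]\<^bsub>complex_units\<^esub> k \<noteq> 0" if "x \<in> ?A" for x
        using complex_units.int_pow_closed[of "\<chi> x" k] \<chi>_hom[OF that that] by simp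
      moreover have "\<chi> (x \<otimes> y) [^]\<^bsub>complex_units\<^esub> k =
          \<chi> x [^]\<^bsub>complex_units\<^esub> k * \<chi> y [^]\<^bsub>complex_units\<^esub> k" if "x \<in> ?A" "y \<in> ?A" for x y
        using complex_units.int_pow_distrib[of "\<chi> x" "\<chi> y" k] \<chi>_hom[OF that] \<chi>_hom[OF that(2,1)] by simp
      ultimately have "?\<psi> \<in> carrier (character_group ?C)"
        by (simp add: character_group_simps hom_complex_units_iff)
      moreover have "?\<psi> a = w" using aA k a by (simp add: \<chi>.hom_int_pow)
      ultimately show "w \<in> ?e ` carrier (character_group ?C)" by (intro image_eqI[of _ _ ?\<psi>]) simp_all
    qed
  qed
  then have "character_group ?C \<cong> ?M" by (auto simp: is_iso_def)
  moreover have "group (character_group ?C)"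
    using comm_group_character_group[of ?C] gC by (simp add: comm_group.axioms(2) group.is_monoid)
  ultimately show ?thesis using iso1 group.iso_sym iso_trans by blast
qed

text \<open>Induction on the order: the kernel of the character faithful on the powers of
  \<open>a\<close> is a complement of that cyclic subgroup and is smaller than \<open>G\<close>
  unless \<open>G\<close> is trivial.\<close>

lemma finite_comm_group_iso_character_group:
  assumes "comm_group G" "finite (carrier G)"
  shows "G \<cong> character_group G"
  using assms
proof (induction "card (carrier G)" arbitrary: G rule: less_induct)
  case (less G)
  interpret comm_group G by fact
  obtain a where a: "a \<in> carrier G" "\<And>b. b \<in> carrier G \<Longrightarrow> b [^]\<^bsub>G\<^esub> ord a = \<one>\<^bsub>G\<^esub>"
    by (rule exponent_element[OF less.prems(2)]) (rule that)
  have pos: "ord a > 0" using ord_ge_1[OF less.prems(2) a(1)] by simp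
  let ?A = "range (\<lambda>k::int. a [^]\<^bsub>G\<^esub> k)"
  obtain \<chi> where \<chi>: "\<chi> \<in> hom G complex_units" "\<chi> ` ?A = {w. w ^ ord a = 1}"
    "\<And>x. x \<in> ?A \<Longrightarrow> \<chi> x = 1 \<Longrightarrow> x = \<one>\<^bsub>G\<^esub>" "\<And>b. b \<in> carrier G \<Longrightarrow> \<chi> b ^ ord a = 1"
    by (rule character_faithful_on_powers[OF a(1) pos]) (use a(2) that in blast)+
  interpret \<chi>: group_hom G complex_units \<chi> using \<chi>(1) by unfold_locales
  let ?K = "kernel G complex_units \<chi>"
  have sA: "subgroup ?A G" by (rule subgroup_of_powers[OF a(1)])
  have surj: "\<chi> ` ?A = \<chi> ` carrier G"
    using \<chi>(2,4) subgroup.subset[OF sA] by blast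
  have A: "G\<lparr>carrier := ?A\<rparr> \<cong> character_group (G\<lparr>carrier := ?A\<rparr>)"
    using a(1) \<chi>(1-3) by (rule is_iso_character_group_powers)
  have "G\<lparr>carrier := ?K\<rparr> \<cong> character_group (G\<lparr>carrier := ?K\<rparr>)"
  proof (cases "?K = carrier G")
    \<comment> \<open>Then \<open>\<chi>\<close> is trivial, so \<open>a\<close> is the identity;
      its order annihilates \<open>G\<close>, and \<open>G\<close> coincides with its trivial cyclic
      subgroup.\<close>
    case True
    have "\<chi> a = 1" using True a(1) by (auto simp: kernel_def)
    moreover have "a \<in> ?A" by (rule image_eqI[of _ _ 1]) (use a in auto)
    ultimately have "a = \<one>\<^bsub>G\<^esub>" using \<chi>(3) by blast
    then have "x = \<one>\<^bsub>G\<^esub>" if "x \<in> carrier G" for x using a(2)[OF that] that by simp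
    then have "carrier G = ?A" using subgroup.subset[OF sA] subgroup.one_closed[OF sA] by blast
    then show ?thesis using True A by simp
  next
    case False
    then have "?K \<subset> carrier G" by (auto simp: kernel_def)
    then have "card ?K < card (carrier G)" using less.prems(2) by (rule psubset_card_mono[rotated])
    moreover have "comm_group (G\<lparr>carrier := ?K\<rparr>)"
      by (rule group.group_comm_groupI[OF subgroup.subgroup_is_group[OF \<chi>.subgroup_kernel is_group]])
        (simp add: kernel_def m_comm)
    moreover have "finite ?K" using \<open>?K \<subset> _\<close> less.prems(2) finite_subset by blast
    ultimately show ?thesis using less.hyps[of "G\<lparr>carrier := ?K\<rparr>"] by simp
  qed
  then show ?case
    using is_iso_character_group_step[OF \<chi>(1) sA \<chi>(3) surj] A by blast
qed

section \<open>Presentations of Lie rings\<close>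

lemma lie_subring_generate:
  assumes "lie_ring F" "T \<subseteq> carrier F"
  shows "lie_subring (lie_generate F T) F"
proof -
  interpret lie_ring F by fact
  have sub: "lie_subring (carrier F) F"
    by (rule lie_subringI[OF assms(1)]) (auto simp: bracket_closed)
  have D: "U \<subseteq> carrier F" "\<zero>\<^bsub>F\<^esub> \<in> U" "x \<in> U \<Longrightarrow> \<ominus>\<^bsub>F\<^esub> x \<in> U"
    "x \<in> U \<Longrightarrow> y \<in> U \<Longrightarrow> x \<oplus>\<^bsub>F\<^esub> y \<in> U" "x \<in> U \<Longrightarrow> y \<in> U \<Longrightarrow> x \<otimes>\<^bsub>F\<^esub> y \<in> U"
    if "lie_subring U F" for U x y
  proof -
    interpret U: lie_subring U F by fact
    show "U \<subseteq> carrier F" "\<zero>\<^bsub>F\<^esub> \<in> U" "x \<in> U \<Longrightarrow> \<ominus>\<^bsub>F\<^esub> x \<in> U"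
      "x \<in> U \<Longrightarrow> y \<in> U \<Longrightarrow> x \<oplus>\<^bsub>F\<^esub> y \<in> U" "x \<in> U \<Longrightarrow> y \<in> U \<Longrightarrow> x \<otimes>\<^bsub>F\<^esub> y \<in> U"
      using U.a_subset U.zero_closed U.a_inv_closed U.a_closed U.bracket_mem
      by auto
  qed
  show ?thesis
    unfolding lie_generate_def
    by (rule lie_subringI[OF assms(1)]) (use sub assms(2) D in auto)
qed

lemma lie_generate_superset: "T \<subseteq> lie_generate F T"
  by (auto simp: lie_generate_def)

lemma lie_generate_minimal: "lie_subring U F \<Longrightarrow> T \<subseteq> U \<Longrightarrow> lie_generate F T \<subseteq> U"
  by (auto simp: lie_generate_def)

lemma lie_hom_eq_on_basis:
  assumes F: "lie_ring F" and B: "lie_basis F B" and M: "lie_ring M"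
    and h: "h \<in> lie_hom F M" and k: "k \<in> lie_hom F M"
    and eq: "\<And>x. x \<in> B \<Longrightarrow> h x = k x" and x: "x \<in> carrier F"
  shows "h x = k x"
proof -
  interpret F: lie_ring F by fact
  let ?E = "{x \<in> carrier F. h x = k x}"
  have "lie_subring ?E F"
    using h k by (intro lie_subringI[OF F])
      (auto simp: lie_hom_zero[OF F M] lie_hom_neg[OF F M] F.bracket_closed,
       auto simp: lie_hom_def)
  moreover have "B \<subseteq> ?E" using eq B by (auto simp: lie_basis_def)
  ultimately have "?E = carrier F" by (rule lie_basis_generates[OF F B])
  then show ?thesis using x by blast
qed

lemma (in lie_ring) bracket_zero:
  assumes "x \<in> carrier L"
  shows "x \<otimes> \<zero> = \<zero>" "\<zero> \<otimes> x = \<zero>"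
proof -
  have "x \<otimes> \<zero> \<oplus> x \<otimes> \<zero> = x \<otimes> \<zero>" "\<zero> \<otimes> x \<oplus> \<zero> \<otimes> x = \<zero> \<otimes> x"
    using assms bracket_add_right[of x \<zero> \<zero>] bracket_add_left[of \<zero> \<zero> x] by simp_all
  then show "x \<otimes> \<zero> = \<zero>" "\<zero> \<otimes> x = \<zero>" using assms by (simp_all add: bracket_closed)
qed

lemma (in lie_ring) bracket_commute:
  assumes "x \<in> carrier L" "y \<in> carrier L"
  shows "x \<otimes> y = \<ominus> (y \<otimes> x)"
proof -
  have "\<zero> = (x \<oplus> y) \<otimes> (x \<oplus> y)" using assms by (simp add: bracket_self)
  also have "\<dots> = (x \<oplus> y) \<otimes> x \<oplus> (x \<oplus> y) \<otimes> y"
    using assms by (intro bracket_add_right) auto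
  also have "\<dots> = y \<otimes> x \<oplus> x \<otimes> y"
    using assms by (simp add: bracket_add_left bracket_closed bracket_self)
  also have "\<dots> = x \<otimes> y \<oplus> y \<otimes> x" using assms by (simp add: a_comm bracket_closed)
  finally have "x \<otimes> y \<oplus> y \<otimes> x = \<zero>" by (rule sym)
  then show ?thesis using assms by (simp add: minus_equality bracket_closed)
qed

text \<open>Every axiom is an identity, hence inherited along a surjection that respects the
  operations. That \<open>h\<close> preserves zero must be assumed, since cancellation in
  \<open>L\<close> is not yet available to derive it.\<close>

lemma lie_ring_surjective_image:
  assumes F: "lie_ring F" and h: "h \<in> lie_hom F L" and surj: "h ` carrier F = carrier L"
    and zero: "h \<zero>\<^bsub>F\<^esub> = \<zero>\<^bsub>L\<^esub>"
  shows "lie_ring L"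
proof -
  interpret F: lie_ring F by fact
  have add: "h x \<oplus>\<^bsub>L\<^esub> h y = h (x \<oplus>\<^bsub>F\<^esub> y)" and mult: "h x \<otimes>\<^bsub>L\<^esub> h y = h (x \<otimes>\<^bsub>F\<^esub> y)"
    if "x \<in> carrier F" "y \<in> carrier F" for x y
    using h that by (auto simp: lie_hom_def)
  have "abelian_group L"
  proof (rule abelian_groupI)
    fix x assume "x \<in> carrier L"
    then obtain a where a: "a \<in> carrier F" "x = h a" using surj by blast
    have "h (\<ominus>\<^bsub>F\<^esub> a) \<oplus>\<^bsub>L\<^esub> x = \<zero>\<^bsub>L\<^esub>" using a by (simp add: add F.l_neg zero)
    moreover have "h (\<ominus>\<^bsub>F\<^esub> a) \<in> carrier L" using surj a(1) by blast
    ultimately show "\<exists>y\<in>carrier L. y \<oplus>\<^bsub>L\<^esub> x = \<zero>\<^bsub>L\<^esub>" by blast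
  qed (auto simp flip: surj zero simp: add F.a_ac)
  then show ?thesis
    by (intro lie_ring.intro lie_ring_axioms.intro)
      (auto simp flip: surj zero simp: add mult F.bracket_closed F.bracket_add_left
        F.bracket_add_right F.bracket_self F.jacobi)
qed

text \<open>The quotient enters as an abstract surjection \<open>q\<close> with kernel
  \<open>relators\<close>, which keeps coset arithmetic out of the cohomological argument.\<close>

locale lie_presentation = lie_ring F + L: lie_ring L
  for F :: "('a, 'm) ring_scheme" (structure) and L :: "('b, 'n) ring_scheme" +
  fixes q :: "'a \<Rightarrow> 'b"
  assumes q_hom: "q \<in> lie_hom F L" and q_surj: "q ` carrier F = carrier L"
begin

definition "relators = {x \<in> carrier F. q x = \<zero>\<^bsub>L\<^esub>}"

abbreviation "lie_derived \<equiv> lie_bracket F (carrier F) (carrier F)"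
abbreviation "lie_central \<equiv> lie_bracket F (carrier F) relators"

lemma q_closed [simp]: "x \<in> carrier F \<Longrightarrow> q x \<in> carrier L"
  using q_surj by blast

lemma q_preimage:
  assumes "x \<in> carrier L"
  obtains a where "a \<in> carrier F" "x = q a"
  using assms q_surj by blast

lemma q_add [simp]: "x \<in> carrier F \<Longrightarrow> y \<in> carrier F \<Longrightarrow> q (x \<oplus> y) = q x \<oplus>\<^bsub>L\<^esub> q y"
  and q_bracket [simp]: "x \<in> carrier F \<Longrightarrow> y \<in> carrier F \<Longrightarrow> q (x \<otimes> y) = q x \<otimes>\<^bsub>L\<^esub> q y"
  using q_hom by (auto simp: lie_hom_def)

lemma q_zero [simp]: "q \<zero> = \<zero>\<^bsub>L\<^esub>"
  by (rule lie_hom_zero[OF lie_ring_axioms L.lie_ring_axioms q_hom])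

lemma q_neg [simp]: "x \<in> carrier F \<Longrightarrow> q (\<ominus> x) = \<ominus>\<^bsub>L\<^esub> q x"
  by (rule lie_hom_neg[OF lie_ring_axioms L.lie_ring_axioms q_hom])

lemma relators_lie_subring: "lie_subring relators F"
  by (rule lie_subringI[OF lie_ring_axioms])
    (auto simp: relators_def bracket_closed L.bracket_zero)

lemma derived_lie_subring: "lie_subring lie_derived F"
  unfolding lie_bracket_def
  by (rule lie_subring_generate[OF lie_ring_axioms]) (auto simp: bracket_closed)

lemma central_lie_subring: "lie_subring lie_central F"
  unfolding lie_bracket_def
  by (rule lie_subring_generate[OF lie_ring_axioms]) (auto simp: relators_def bracket_closed)

lemma derived_minimal:
  assumes "lie_subring U F" "\<And>x y. x \<in> carrier F \<Longrightarrow> y \<in> carrier F \<Longrightarrow> x \<otimes> y \<in> U"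
  shows "lie_derived \<subseteq> U"
  unfolding lie_bracket_def by (rule lie_generate_minimal[OF assms(1)]) (use assms(2) in auto)

lemma central_minimal:
  assumes "lie_subring U F" "\<And>x y. x \<in> carrier F \<Longrightarrow> y \<in> relators \<Longrightarrow> x \<otimes> y \<in> U"
  shows "lie_central \<subseteq> U"
  unfolding lie_bracket_def by (rule lie_generate_minimal[OF assms(1)]) (use assms(2) in auto)

lemma bracket_in_derived: "x \<in> carrier F \<Longrightarrow> y \<in> carrier F \<Longrightarrow> x \<otimes> y \<in> lie_derived"
  unfolding lie_bracket_def by (rule subsetD[OF lie_generate_superset]) blast

lemma bracket_in_central: "x \<in> carrier F \<Longrightarrow> y \<in> relators \<Longrightarrow> x \<otimes> y \<in> lie_central"
  unfolding lie_bracket_def by (rule subsetD[OF lie_generate_superset]) blast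

lemma central_subset: "lie_central \<subseteq> relators \<inter> lie_derived"
proof -
  interpret D: lie_subring lie_derived F by (rule derived_lie_subring)
  have "lie_central \<subseteq> relators"
    by (rule central_minimal[OF relators_lie_subring])
      (auto simp: relators_def bracket_closed L.bracket_zero)
  moreover have "lie_central \<subseteq> lie_derived"
    by (rule central_minimal[OF derived_lie_subring]) (auto simp: relators_def bracket_in_derived)
  ultimately show ?thesis by blast
qed

text \<open>These equations say that \<open>x \<mapsto> (c x, q x)\<close> respects the operations
  of the extension built from \<open>(f, g)\<close>. Fixing the value at zero normalizes
  \<open>f\<close> and \<open>g\<close>: for arbitrary pairs, the other equations would allow
  \<open>c \<zero>\<close> to differ from 1.\<close>

definition lift :: "('b \<times> 'b \<Rightarrow> complex) \<Rightarrow> ('b \<times> 'b \<Rightarrow> complex) \<Rightarrow> ('a \<Rightarrow> complex) \<Rightarrow> bool" where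
  "lift f g c \<longleftrightarrow> c \<zero> = 1 \<and> (\<forall>x\<in>carrier F. c x \<noteq> 0) \<and>
     (\<forall>x\<in>carrier F. \<forall>y\<in>carrier F.
        c (x \<oplus> y) = c x * c y * g (q x, q y) \<and> c (x \<otimes> y) = f (q x, q y))"

lemma liftD:
  assumes "lift f g c"
  shows "c \<zero> = 1" "x \<in> carrier F \<Longrightarrow> c x \<noteq> 0"
    "x \<in> carrier F \<Longrightarrow> y \<in> carrier F \<Longrightarrow> c (x \<oplus> y) = c x * c y * g (q x, q y)"
    "x \<in> carrier F \<Longrightarrow> y \<in> carrier F \<Longrightarrow> c (x \<otimes> y) = f (q x, q y)"
  using assms by (auto simp: lift_def)

lemma lift_g:
  assumes "lift f g c" "x \<in> carrier F" "y \<in> carrier F"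
  shows "g (q x, q y) = c (x \<oplus> y) / (c x * c y)"
  using liftD[OF assms(1)] assms(2,3) by simp

lemma lift_g_zero:
  assumes "lift f g c" "x \<in> carrier F"
  shows "g (q x, \<zero>\<^bsub>L\<^esub>) = 1" "g (\<zero>\<^bsub>L\<^esub>, q x) = 1"
  using lift_g[OF assms, of \<zero>] lift_g[OF assms(1) _ assms(2), of \<zero>] liftD(1,2)[OF assms(1)] assms(2)
  by simp_all

text \<open>Through a lift, \<open>f\<close> and \<open>g\<close> become expressions in values of
  \<open>c\<close> at brackets and sums, so each cocycle condition is a Lie ring identity of
  \<open>F\<close> read through \<open>c\<close>. This replaces direct verification for products,
  inverses, coboundaries and the cocycles constructed from characters.\<close>

lemma cocycle2_of_lift:
  assumes c: "lift f g c"
  shows "cocycle2 L complex_units f g"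
  unfolding cocycle2_def
proof (intro ballI)
  fix x y z assume "x \<in> carrier L" "y \<in> carrier L" "z \<in> carrier L"
  then obtain a b d where abd: "a \<in> carrier F" "b \<in> carrier F" "d \<in> carrier F"
    and xyz: "x = q a" "y = q b" "z = q d"
    by (elim q_preimage)
  note [simp] = abd bracket_closed
  note D = liftD[OF c]
  have fe: "f (q u, q v) = c (u \<otimes> v)" if "u \<in> carrier F" "v \<in> carrier F" for u v
    using D(4)[OF that] by simp
  have g0: "g (q u, q v) \<noteq> 0" if "u \<in> carrier F" "v \<in> carrier F" for u v
    using lift_g[OF c that] D(2) that by simp
  have 1: "f (x \<oplus>\<^bsub>L\<^esub> y, z) = f (x, z) * f (y, z) * g (x \<otimes>\<^bsub>L\<^esub> z, y \<otimes>\<^bsub>L\<^esub> z)"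
    unfolding xyz using D(3)[of "a \<otimes> d" "b \<otimes> d"] fe[of "a \<oplus> b" d] fe[of a d] fe[of b d]
    by (simp add: bracket_add_left)
  have 2: "f (x, y \<oplus>\<^bsub>L\<^esub> z) = f (x, y) * f (x, z) * g (x \<otimes>\<^bsub>L\<^esub> y, x \<otimes>\<^bsub>L\<^esub> z)"
    unfolding xyz using D(3)[of "a \<otimes> b" "a \<otimes> d"] fe[of a "b \<oplus> d"] fe[of a b] fe[of a d]
    by (simp add: bracket_add_right)
  have 3: "f (x, x) = 1" unfolding xyz using fe[of a a] D(1) by (simp add: bracket_self)
  have 5: "g (x \<oplus>\<^bsub>L\<^esub> y, z) * g (x, y) = g (x, y \<oplus>\<^bsub>L\<^esub> z) * g (y, z)"
    unfolding xyz using lift_g[OF c, of "a \<oplus> b" d] lift_g[OF c, of a "b \<oplus> d"]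
      lift_g[OF c, of a b] lift_g[OF c, of b d] D(2)[of a] D(2)[of b] D(2)[of d]
      D(2)[of "a \<oplus> b"] D(2)[of "b \<oplus> d"]
    by (simp add: a_assoc)
  have 6: "g (x, y) = g (y, x)"
    unfolding xyz using lift_g[OF c, of a b] lift_g[OF c, of b a] by (simp add: a_comm mult.commute)
  let ?A = "a \<otimes> (b \<otimes> d)" and ?B = "b \<otimes> (d \<otimes> a)" and ?C = "d \<otimes> (a \<otimes> b)"
  have "?A \<oplus> ?C \<oplus> ?B = \<zero>" using jacobi[of a b d] by (simp add: a_ac)
  \<comment> \<open>The two \<open>g\<close> terms of the Jacobi condition come from adding the
    three brackets in two stages: \<open>?A \<oplus> ?C\<close>, which is
    \<open>\<ominus> ?B\<close>, and then \<open>\<ominus> ?B \<oplus> ?B\<close>.\<close>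
  then have AC: "?A \<oplus> ?C = \<ominus> ?B" by (simp add: minus_equality)
  have "f (q a, q (b \<otimes> d)) * f (q d, q (a \<otimes> b)) * f (q b, q (d \<otimes> a)) = c ?A * c ?C * c ?B"
    by (simp only: fe abd bracket_closed)
  moreover have "c (\<ominus> ?B) = c ?A * c ?C * g (q ?A, q ?C)" using D(3)[of ?A ?C] AC by simp
  moreover have "1 = c (\<ominus> ?B) * c ?B * g (q (\<ominus> ?B), q ?B)"
    using D(3)[of "\<ominus> ?B" ?B] D(1) by (simp add: l_neg)
  moreover have "g (q ?A, q ?C) \<noteq> 0" "g (q (\<ominus> ?B), q ?B) \<noteq> 0" by (rule g0; simp)+
  ultimately have "f (q a, q (b \<otimes> d)) * f (q d, q (a \<otimes> b)) * f (q b, q (d \<otimes> a)) =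
      inverse (g (q ?A, q ?C)) * inverse (g (q (\<ominus> ?B), q ?B))"
    by (simp add: field_simps)
  moreover have "inv\<^bsub>complex_units\<^esub> g (q ?A, q ?C) = inverse (g (q ?A, q ?C))"
    "inv\<^bsub>complex_units\<^esub> g (q (\<ominus> ?B), q ?B) = inverse (g (q (\<ominus> ?B), q ?B))"
    by (rule complex_units_inv; rule g0; simp)+
  ultimately have 4: "f (x, y \<otimes>\<^bsub>L\<^esub> z) * f (z, x \<otimes>\<^bsub>L\<^esub> y) * f (y, z \<otimes>\<^bsub>L\<^esub> x) =
      inv\<^bsub>complex_units\<^esub> g (x \<otimes>\<^bsub>L\<^esub> (y \<otimes>\<^bsub>L\<^esub> z), z \<otimes>\<^bsub>L\<^esub> (x \<otimes>\<^bsub>L\<^esub> y)) *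
      inv\<^bsub>complex_units\<^esub> g (\<ominus>\<^bsub>L\<^esub> (y \<otimes>\<^bsub>L\<^esub> (z \<otimes>\<^bsub>L\<^esub> x)), y \<otimes>\<^bsub>L\<^esub> (z \<otimes>\<^bsub>L\<^esub> x))"
    unfolding xyz by simp
  show "f (x \<oplus>\<^bsub>L\<^esub> y, z) = f (x, z) \<otimes>\<^bsub>complex_units\<^esub> f (y, z) \<otimes>\<^bsub>complex_units\<^esub> g (x \<otimes>\<^bsub>L\<^esub> z, y \<otimes>\<^bsub>L\<^esub> z) \<and>
        f (x, y \<oplus>\<^bsub>L\<^esub> z) = f (x, y) \<otimes>\<^bsub>complex_units\<^esub> f (x, z) \<otimes>\<^bsub>complex_units\<^esub> g (x \<otimes>\<^bsub>L\<^esub> y, x \<otimes>\<^bsub>L\<^esub> z) \<and>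
        f (x, x) = \<one>\<^bsub>complex_units\<^esub> \<and>
        f (x, y \<otimes>\<^bsub>L\<^esub> z) \<otimes>\<^bsub>complex_units\<^esub> f (z, x \<otimes>\<^bsub>L\<^esub> y) \<otimes>\<^bsub>complex_units\<^esub> f (y, z \<otimes>\<^bsub>L\<^esub> x) =
          inv\<^bsub>complex_units\<^esub> g (x \<otimes>\<^bsub>L\<^esub> (y \<otimes>\<^bsub>L\<^esub> z), z \<otimes>\<^bsub>L\<^esub> (x \<otimes>\<^bsub>L\<^esub> y)) \<otimes>\<^bsub>complex_units\<^esub>
          inv\<^bsub>complex_units\<^esub> g (\<ominus>\<^bsub>L\<^esub> (y \<otimes>\<^bsub>L\<^esub> (z \<otimes>\<^bsub>L\<^esub> x)), y \<otimes>\<^bsub>L\<^esub> (z \<otimes>\<^bsub>L\<^esub> x)) \<and>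
        g (x \<oplus>\<^bsub>L\<^esub> y, z) \<otimes>\<^bsub>complex_units\<^esub> g (x, y) = g (x, y \<oplus>\<^bsub>L\<^esub> z) \<otimes>\<^bsub>complex_units\<^esub> g (y, z) \<and>
        g (x, y) = g (y, x)"
    unfolding complex_units_simps using 1 2 3 4 5 6 by (intro conjI)
qed

end

section \<open>Cocycles and extensions\<close>

context lie_ring
begin

text \<open>The bracket ignores the complex entries because the kernel of the extension is to be
  central with zero bracket.\<close>

definition cocycle_extension :: "('a \<times> 'a \<Rightarrow> complex) \<Rightarrow> ('a \<times> 'a \<Rightarrow> complex) \<Rightarrow> (complex \<times> 'a) ring" where
  "cocycle_extension f g = \<lparr>carrier = (- {0}) \<times> carrier L,
     monoid.mult = (\<lambda>u v. (f (snd u, snd v), snd u \<otimes> snd v)), one = (1, \<zero>),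
     ring.zero = (1, \<zero>), add = (\<lambda>u v. (fst u * fst v * g (snd u, snd v), snd u \<oplus> snd v))\<rparr>"

lemma cocycle_extension_simps:
  "carrier (cocycle_extension f g) = (- {0}) \<times> carrier L"
  "\<zero>\<^bsub>cocycle_extension f g\<^esub> = (1, \<zero>)"
  "(a, x) \<oplus>\<^bsub>cocycle_extension f g\<^esub> (b, y) = (a * b * g (x, y), x \<oplus> y)"
  "(a, x) \<otimes>\<^bsub>cocycle_extension f g\<^esub> (b, y) = (f (x, y), x \<otimes> y)"
  by (simp_all add: cocycle_extension_def)

lemma lie_ring_cocycle_extension:
  assumes cocycle: "cocycle2 L complex_units f g"
    and nz: "\<And>x y. x \<in> carrier L \<Longrightarrow> y \<in> carrier L \<Longrightarrow> f (x, y) \<noteq> 0"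
      "\<And>x y. x \<in> carrier L \<Longrightarrow> y \<in> carrier L \<Longrightarrow> g (x, y) \<noteq> 0"
  shows "lie_ring (cocycle_extension f g)"
proof -
  let ?E = "cocycle_extension f g"
  note [simp] = bracket_closed
  have c1: "f (x \<oplus> y, z) = f (x, z) * f (y, z) * g (x \<otimes> z, y \<otimes> z)"
    and c2: "f (x, y \<oplus> z) = f (x, y) * f (x, z) * g (x \<otimes> y, x \<otimes> z)"
    and c3: "f (x, x) = 1"
    and c4: "f (x, y \<otimes> z) * f (z, x \<otimes> y) * f (y, z \<otimes> x) =
          inverse (g (x \<otimes> (y \<otimes> z), z \<otimes> (x \<otimes> y))) *
          inverse (g (\<ominus> (y \<otimes> (z \<otimes> x)), y \<otimes> (z \<otimes> x)))"
    and c5: "g (x \<oplus> y, z) * g (x, y) = g (x, y \<oplus> z) * g (y, z)"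
    and c6: "g (x, y) = g (y, x)"
    if "x \<in> carrier L" "y \<in> carrier L" "z \<in> carrier L" for x y z
  proof -
    note * = cocycle[unfolded cocycle2_def, rule_format, OF that, unfolded complex_units_simps]
    show "f (x \<oplus> y, z) = f (x, z) * f (y, z) * g (x \<otimes> z, y \<otimes> z)"
      "f (x, y \<oplus> z) = f (x, y) * f (x, z) * g (x \<otimes> y, x \<otimes> z)" "f (x, x) = 1"
      "g (x \<oplus> y, z) * g (x, y) = g (x, y \<oplus> z) * g (y, z)" "g (x, y) = g (y, x)"
      using * by - (elim conjE, assumption)+
    show "f (x, y \<otimes> z) * f (z, x \<otimes> y) * f (y, z \<otimes> x) =
          inverse (g (x \<otimes> (y \<otimes> z), z \<otimes> (x \<otimes> y))) *
          inverse (g (\<ominus> (y \<otimes> (z \<otimes> x)), y \<otimes> (z \<otimes> x)))"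
      using * nz(2)[of "x \<otimes> (y \<otimes> z)" "z \<otimes> (x \<otimes> y)"]
        nz(2)[of "\<ominus> (y \<otimes> (z \<otimes> x))" "y \<otimes> (z \<otimes> x)"] that
      by simp
  qed
  \<comment> \<open>This normalization, which makes \<open>(1, \<zero>)\<close> neutral, is no
    separate cocycle condition; it follows from distributivity at zero together with
    \<open>f (\<zero>, \<zero>) = 1\<close>.\<close>
  have "g (\<zero>, \<zero>) = 1"
    using c1[of \<zero> \<zero> \<zero>] c3[of \<zero> \<zero> \<zero>] by (simp add: bracket_zero)
  then have g0: "g (\<zero>, x) = 1" if "x \<in> carrier L" for x
    using c5[of \<zero> \<zero> x] nz(2)[of \<zero> x] that by simp
  have "abelian_group ?E"
  proof (rule abelian_groupI)
    fix u v w assume "u \<in> carrier ?E" "v \<in> carrier ?E" "w \<in> carrier ?E"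
    then obtain a x b y d z where "u = (a, x)" "v = (b, y)" "w = (d, z)"
      and mem: "x \<in> carrier L" "y \<in> carrier L" "z \<in> carrier L"
      by (cases u, cases v, cases w) (simp add: cocycle_extension_simps)
    then show "u \<oplus>\<^bsub>?E\<^esub> v \<oplus>\<^bsub>?E\<^esub> w = u \<oplus>\<^bsub>?E\<^esub> (v \<oplus>\<^bsub>?E\<^esub> w)"
      using c5[OF mem] by (simp add: cocycle_extension_simps a_assoc) (simp add: mult_ac)
  next
    fix u v assume "u \<in> carrier ?E" "v \<in> carrier ?E"
    then obtain a x b y where "u = (a, x)" "v = (b, y)"
      and mem: "x \<in> carrier L" "y \<in> carrier L"
      by (cases u, cases v) (simp add: cocycle_extension_simps)
    then show "u \<oplus>\<^bsub>?E\<^esub> v = v \<oplus>\<^bsub>?E\<^esub> u"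
      using c6[OF mem(1,2,2)] by (simp add: cocycle_extension_simps a_comm)
  next
    fix u assume "u \<in> carrier ?E"
    then obtain a x where u: "u = (a, x)" "a \<noteq> 0" "x \<in> carrier L"
      by (cases u) (simp add: cocycle_extension_simps)
    let ?v = "(inverse (a * g (\<ominus> x, x)), \<ominus> x)"
    have "?v \<in> carrier ?E" "?v \<oplus>\<^bsub>?E\<^esub> u = \<zero>\<^bsub>?E\<^esub>"
      using u nz(2)[of "\<ominus> x" x] by (simp_all add: cocycle_extension_simps l_neg field_simps)
    then show "\<exists>v\<in>carrier ?E. v \<oplus>\<^bsub>?E\<^esub> u = \<zero>\<^bsub>?E\<^esub>" by blast
  qed (auto simp: cocycle_extension_simps g0 nz)
  then show ?thesis
  proof (intro lie_ring.intro lie_ring_axioms.intro)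
    fix u v w assume "u \<in> carrier ?E" "v \<in> carrier ?E" "w \<in> carrier ?E"
    then obtain a x b y d z where uvw: "u = (a, x)" "v = (b, y)" "w = (d, z)"
      and mem: "x \<in> carrier L" "y \<in> carrier L" "z \<in> carrier L"
      by (cases u, cases v, cases w) (simp add: cocycle_extension_simps)
    show "(u \<oplus>\<^bsub>?E\<^esub> v) \<otimes>\<^bsub>?E\<^esub> w = u \<otimes>\<^bsub>?E\<^esub> w \<oplus>\<^bsub>?E\<^esub> v \<otimes>\<^bsub>?E\<^esub> w"
      using c1[OF mem] mem uvw by (simp add: cocycle_extension_simps bracket_add_left)
    show "u \<otimes>\<^bsub>?E\<^esub> (v \<oplus>\<^bsub>?E\<^esub> w) = u \<otimes>\<^bsub>?E\<^esub> v \<oplus>\<^bsub>?E\<^esub> u \<otimes>\<^bsub>?E\<^esub> w"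
      using c2[OF mem] mem uvw by (simp add: cocycle_extension_simps bracket_add_right)
    let ?A = "x \<otimes> (y \<otimes> z)" and ?B = "y \<otimes> (z \<otimes> x)" and ?C = "z \<otimes> (x \<otimes> y)"
    have sum: "?A \<oplus> ?B \<oplus> ?C = \<zero>" by (rule jacobi[OF mem])
    then have "?A \<oplus> ?C \<oplus> ?B = \<zero>" using mem by (simp add: a_ac)
    then have AC: "?A \<oplus> ?C = \<ominus> ?B" using mem by (simp add: minus_equality)
    \<comment> \<open>The Jacobi sum in the extension adds the brackets in the order A, B, C, while
      the cocycle condition pairs A with C first. The 2-cocycle identity and symmetry of
      \<open>g\<close> mediate between the two orders.\<close>
    have "g (?A \<oplus> ?B, ?C) * g (?A, ?B) = g (?A \<oplus> ?C, ?B) * g (?A, ?C)"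
      using c5[of ?A ?B ?C] c5[of ?A ?C ?B] c6[of ?B ?C ?C] mem by (simp add: a_comm)
    moreover have "f (x, y \<otimes> z) * f (z, x \<otimes> y) * f (y, z \<otimes> x) * (g (?A \<oplus> ?C, ?B) * g (?A, ?C)) = 1"
      unfolding c4[OF mem] AC using mem nz(2)[of ?A ?C] nz(2)[of "\<ominus> ?B" ?B] by (simp add: field_simps)
    ultimately have "f (x, y \<otimes> z) * f (y, z \<otimes> x) * g (?A, ?B) * f (z, x \<otimes> y) * g (?A \<oplus> ?B, ?C) = 1"
      by (simp add: mult_ac)
    then show "u \<otimes>\<^bsub>?E\<^esub> (v \<otimes>\<^bsub>?E\<^esub> w) \<oplus>\<^bsub>?E\<^esub> v \<otimes>\<^bsub>?E\<^esub> (w \<otimes>\<^bsub>?E\<^esub> u) \<oplus>\<^bsub>?E\<^esub> w \<otimes>\<^bsub>?E\<^esub> (u \<otimes>\<^bsub>?E\<^esub> v) = \<zero>\<^bsub>?E\<^esub>"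
      using uvw sum by (simp add: cocycle_extension_simps)
  next
    fix u assume "u \<in> carrier ?E"
    then obtain a x where "u = (a, x)" "x \<in> carrier L"
      by (cases u) (simp add: cocycle_extension_simps)
    then show "u \<otimes>\<^bsub>?E\<^esub> u = \<zero>\<^bsub>?E\<^esub>"
      using c3[of x x x] by (simp add: cocycle_extension_simps bracket_self)
  next
    fix u v assume "u \<in> carrier ?E" "v \<in> carrier ?E"
    then show "u \<otimes>\<^bsub>?E\<^esub> v \<in> carrier ?E"
      by (cases u, cases v) (simp add: cocycle_extension_simps nz)
  qed
qed

end

context lie_presentation
begin

text \<open>The extension has complex entries, so freeness is applied through
  \<open>lie_basis_universal\<close>, which admits targets over any type. The second component of
  the resulting homomorphism is \<open>q\<close>, because both agree on the basis.\<close>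

lemma lift_exists:
  assumes basis: "lie_basis F B" and cocycle: "cocycle2 L complex_units f g"
    and nz: "\<And>x y. x \<in> carrier L \<Longrightarrow> y \<in> carrier L \<Longrightarrow> f (x, y) \<noteq> 0"
      "\<And>x y. x \<in> carrier L \<Longrightarrow> y \<in> carrier L \<Longrightarrow> g (x, y) \<noteq> 0"
  obtains c where "lift f g c"
proof -
  let ?E = "L.cocycle_extension f g"
  have E: "lie_ring ?E" by (rule L.lie_ring_cocycle_extension[OF cocycle nz])
  have BF: "B \<subseteq> carrier F" using basis by (simp add: lie_basis_def)
  \<comment> \<open>The first component on the basis may be any nonzero number; 1 is an arbitrary
    choice.\<close>
  then have "(\<lambda>b. (1, q b)) \<in> B \<rightarrow> carrier ?E" by (auto simp: L.cocycle_extension_simps)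
  from lie_basis_universal[OF lie_ring_axioms basis E this]
  obtain h where h: "h \<in> lie_hom F ?E" "\<And>x. x \<in> B \<Longrightarrow> h x = (1, q x)" by auto
  have add: "h (x \<oplus> y) = h x \<oplus>\<^bsub>?E\<^esub> h y" and mult: "h (x \<otimes> y) = h x \<otimes>\<^bsub>?E\<^esub> h y"
    if "x \<in> carrier F" "y \<in> carrier F" for x y
    using h(1) that by (simp_all add: lie_hom_def)
  have mem: "fst (h x) \<noteq> 0" "snd (h x) \<in> carrier L" if "x \<in> carrier F" for x
  proof -
    have "h x \<in> carrier ?E" using h(1) that by (auto simp: lie_hom_def)
    then show "fst (h x) \<noteq> 0" "snd (h x) \<in> carrier L"
      by (auto simp: L.cocycle_extension_simps mem_Times_iff)
  qed
  have E_ops: "u \<oplus>\<^bsub>?E\<^esub> v = (fst u * fst v * g (snd u, snd v), snd u \<oplus>\<^bsub>L\<^esub> snd v)"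
    "u \<otimes>\<^bsub>?E\<^esub> v = (f (snd u, snd v), snd u \<otimes>\<^bsub>L\<^esub> snd v)" for u v
    by (simp_all add: L.cocycle_extension_def)
  have "(\<lambda>x. snd (h x)) \<in> lie_hom F L"
    unfolding lie_hom_def using mem(2) by (auto simp: add mult E_ops)
  then have snd: "snd (h x) = q x" if "x \<in> carrier F" for x
    using lie_hom_eq_on_basis[OF lie_ring_axioms basis L.lie_ring_axioms _ q_hom _ that] h(2) by simp
  show ?thesis
  proof (rule that)
    show "lift f g (\<lambda>x. fst (h x))"
      unfolding lift_def
      using mem(1) lie_hom_zero[OF lie_ring_axioms E h(1)]
      by (simp add: add mult E_ops snd L.cocycle_extension_simps)
  qed
qed

section \<open>Products of lifts and their values on \<open>F^2\<close>, \<open>R\<close> and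
  \<open>[F, R]\<close>\<close>

lemma lift_mult:
  assumes "lift f g c" "lift f' g' c'"
    and "\<And>x y. x \<in> carrier L \<Longrightarrow> y \<in> carrier L \<Longrightarrow> f'' (x, y) = f (x, y) * f' (x, y)"
    and "\<And>x y. x \<in> carrier L \<Longrightarrow> y \<in> carrier L \<Longrightarrow> g'' (x, y) = g (x, y) * g' (x, y)"
  shows "lift f'' g'' (\<lambda>x. c x * c' x)"
  using assms by (simp add: lift_def mult_ac)

lemma lift_inverse:
  assumes "lift f g c"
    and "\<And>x y. x \<in> carrier L \<Longrightarrow> y \<in> carrier L \<Longrightarrow> f' (x, y) = inverse (f (x, y))"
    and "\<And>x y. x \<in> carrier L \<Longrightarrow> y \<in> carrier L \<Longrightarrow> g' (x, y) = inverse (g (x, y))"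
  shows "lift f' g' (\<lambda>x. inverse (c x))"
  using assms by (simp add: lift_def)

text \<open>The points where \<open>e\<close> equals 1 form a Lie subring containing all brackets,
  hence containing \<open>F^2\<close>. Applied to the quotient of two lifts, this gives
  uniqueness.\<close>

lemma trivial_on_derived:
  assumes "\<And>x. x \<in> carrier F \<Longrightarrow> e x \<noteq> (0::complex)"
    and add: "\<And>x y. x \<in> carrier F \<Longrightarrow> y \<in> carrier F \<Longrightarrow> e (x \<oplus> y) = e x * e y"
    and bracket: "\<And>x y. x \<in> carrier F \<Longrightarrow> y \<in> carrier F \<Longrightarrow> e (x \<otimes> y) = 1"
    and "x \<in> lie_derived"
  shows "e x = 1"
proof -
  have zero: "e \<zero> = 1" using add[of \<zero> \<zero>] assms(1)[of \<zero>] by simp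
  have "lie_subring {x \<in> carrier F. e x = 1} F"
  proof (rule lie_subringI[OF lie_ring_axioms])
    fix x assume "x \<in> {x \<in> carrier F. e x = 1}"
    then show "\<ominus> x \<in> {x \<in> carrier F. e x = 1}"
      using add[of "\<ominus> x" x] zero by (simp add: l_neg)
  qed (use zero in \<open>auto simp: add bracket bracket_closed\<close>)
  then have "lie_derived \<subseteq> {x \<in> carrier F. e x = 1}"
    by (rule derived_minimal) (simp add: bracket bracket_closed)
  then show ?thesis using assms(4) by blast
qed

lemma lift_unique:
  assumes c: "lift f g c" and c': "lift f g c'" and x: "x \<in> lie_derived"
  shows "c x = c' x"
proof -
  have gnz: "g (q y, q z) \<noteq> 0" if "y \<in> carrier F" "z \<in> carrier F" for y z
    using lift_g[OF c that] liftD(2)[OF c] that by simp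
  have fnz: "f (q y, q z) \<noteq> 0" if "y \<in> carrier F" "z \<in> carrier F" for y z
    using liftD(4)[OF c that] liftD(2)[OF c, of "y \<otimes> z"] that by (simp add: bracket_closed)
  have "c x / c' x = 1"
  proof (rule trivial_on_derived[where e = "\<lambda>x. c x / c' x"])
    fix y z assume "y \<in> carrier F" "z \<in> carrier F"
    then show "c (y \<oplus> z) / c' (y \<oplus> z) = c y / c' y * (c z / c' z)"
      "c (y \<otimes> z) / c' (y \<otimes> z) = 1"
      using gnz fnz liftD(3,4)[OF c] liftD(3,4)[OF c'] by simp_all
  qed (use x liftD(2)[OF c] liftD(2)[OF c'] in simp_all)
  then show ?thesis by (simp add: divide_eq_1_iff)
qed

text \<open>A single summand in \<open>R\<close> is enough for multiplicativity, because
  \<open>g\<close> is 1 as soon as one argument is zero. This is what later makes a lift that is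
  trivial on \<open>R\<close> constant on cosets.\<close>

lemma lift_on_relators:
  assumes c: "lift f g c" and x: "x \<in> relators" and y: "y \<in> carrier F"
  shows "c (x \<oplus> y) = c x * c y" "c (y \<oplus> x) = c y * c x"
  using liftD(3)[OF c, of x y] liftD(3)[OF c, of y x] lift_g_zero[OF c y] x y
  by (simp_all add: relators_def)

lemma relators_bracket: "x \<in> carrier F \<Longrightarrow> y \<in> relators \<Longrightarrow> x \<otimes> y \<in> relators"
  by (simp add: relators_def bracket_closed L.bracket_zero)

text \<open>The value \<open>f (q x, q y)\<close> cannot distinguish a relator \<open>y\<close> from
  zero, so \<open>c\<close> takes the same value at \<open>x \<otimes> y\<close> as at
  \<open>x \<otimes> \<zero>\<close>. Inside \<open>R\<close>, where \<open>c\<close> is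
  multiplicative, this spreads to all of \<open>[F, R]\<close>.\<close>

lemma lift_on_central:
  assumes c: "lift f g c" and x: "x \<in> lie_central"
  shows "c x = 1"
proof -
  have mem: "x \<in> carrier F" "q x = \<zero>\<^bsub>L\<^esub>" if "x \<in> relators" for x
    using that by (simp_all add: relators_def)
  interpret R: lie_subring relators F by (rule relators_lie_subring)
  have bracket: "c (x \<otimes> y) = 1" if "x \<in> carrier F" "y \<in> relators" for x y
  proof -
    have "c (x \<otimes> y) = f (q x, \<zero>\<^bsub>L\<^esub>)"
      using liftD(4)[OF c, of x y] mem that by simp
    also have "\<dots> = c (x \<otimes> \<zero>)" using liftD(4)[OF c, of x \<zero>] that by simp
    finally show ?thesis using that liftD(1)[OF c] by (simp add: bracket_zero)
  qed
  have "lie_subring {x \<in> relators. c x = 1} F"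
  proof (rule lie_subringI[OF lie_ring_axioms])
    fix x assume "x \<in> {x \<in> relators. c x = 1}"
    then show "\<ominus> x \<in> {x \<in> relators. c x = 1}"
      using lift_on_relators(1)[OF c, of x "\<ominus> x"] liftD(1)[OF c] mem by (simp add: r_neg R.a_inv_closed)
  next
    fix x y assume "x \<in> {x \<in> relators. c x = 1}" "y \<in> {x \<in> relators. c x = 1}"
    then show "x \<oplus> y \<in> {x \<in> relators. c x = 1}" "x \<otimes> y \<in> {x \<in> relators. c x = 1}"
      using lift_on_relators(1)[OF c, of x y] bracket[of x y] mem R.a_closed R.bracket_mem by simp_all
  qed (use mem liftD(1)[OF c] in auto)
  then have "lie_central \<subseteq> {x \<in> relators. c x = 1}"
    by (rule central_minimal)
      (use bracket in \<open>auto intro: relators_bracket\<close>)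
  then show ?thesis using x by blast
qed

end

section \<open>Characters trivial on a subgroup\<close>

text \<open>The dual of \<open>G Mod N\<close>, kept as functions on \<open>G\<close> so that
  restrictions of lifts are members without passing to cosets.\<close>

definition annihilator :: "('a, 'm) monoid_scheme \<Rightarrow> 'a set \<Rightarrow> ('a \<Rightarrow> complex) monoid" where
  "annihilator G N = (character_group G)
     \<lparr>carrier := {\<chi> \<in> carrier (character_group G). \<forall>x\<in>N. \<chi> x = 1}\<rparr>"

lemma annihilator_simps:
  "\<chi> \<in> carrier (annihilator G N) \<longleftrightarrow>
     \<chi> \<in> hom G complex_units \<and> \<chi> \<in> extensional (carrier G) \<and> (\<forall>x\<in>N. \<chi> x = 1)"
  "\<chi> \<otimes>\<^bsub>annihilator G N\<^esub> \<psi> = (\<lambda>x\<in>carrier G. \<chi> x * \<psi> x)"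
  "\<one>\<^bsub>annihilator G N\<^esub> = (\<lambda>x\<in>carrier G. 1)"
  by (auto simp: annihilator_def character_group_simps)

context comm_group
begin

lemma group_annihilator:
  assumes "subgroup N G"
  shows "group (annihilator G N)"
proof (rule groupI)
  interpret N: subgroup N G by fact
  fix \<chi> assume \<chi>: "\<chi> \<in> carrier (annihilator G N)"
  then have "(\<lambda>x\<in>carrier G. inverse (\<chi> x)) \<in> carrier (annihilator G N)"
    using N.mem_carrier by (auto simp: annihilator_simps hom_complex_units_iff)
  moreover have "(\<lambda>x\<in>carrier G. inverse (\<chi> x)) \<otimes>\<^bsub>annihilator G N\<^esub> \<chi> = \<one>\<^bsub>annihilator G N\<^esub>"
    using \<chi> by (auto simp: annihilator_simps hom_complex_units_iff fun_eq_iff)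
  ultimately show "\<exists>\<psi>\<in>carrier (annihilator G N). \<psi> \<otimes>\<^bsub>annihilator G N\<^esub> \<chi> = \<one>\<^bsub>annihilator G N\<^esub>"
    by blast
qed (use subgroup.mem_carrier[OF assms] in
  \<open>auto simp: annihilator_simps hom_complex_units_iff fun_eq_iff extensional_def mult_ac\<close>)

lemma character_group_Mod_iso:
  assumes N: "subgroup N G"
  shows "character_group (G Mod N) \<cong> annihilator G N"
proof -
  interpret N: normal N G by (rule subgroup_imp_normal[OF N])
  have carrier: "carrier (G Mod N) = (\<lambda>x. N #> x) ` carrier G" by (rule carrier_FactGroup)
  let ?\<pi> = "\<lambda>\<psi>. \<lambda>x\<in>carrier G. \<psi> (N #> x)"
  have "?\<pi> \<in> iso (character_group (G Mod N)) (annihilator G N)"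
  proof (rule isoI)
    show hom: "?\<pi> \<in> hom (character_group (G Mod N)) (annihilator G N)"
    proof (rule homI)
      fix \<psi> assume "\<psi> \<in> carrier (character_group (G Mod N))"
      then have \<psi>: "\<psi> (N #> x) \<noteq> 0" "\<psi> ((N #> x) <#> (N #> y)) = \<psi> (N #> x) * \<psi> (N #> y)"
        if "x \<in> carrier G" "y \<in> carrier G" for x y
        using that by (auto simp: character_group_simps hom_complex_units_iff carrier)
      have "\<psi> N * \<psi> N = \<psi> N" "\<psi> N \<noteq> 0"
        using \<psi>[of \<one> \<one>] N.subset coset_mult_one[OF N.subset] subgroup_mult_id[OF N] by simp_all
      then have "\<psi> N = 1" by simp
      then show "?\<pi> \<psi> \<in> carrier (annihilator G N)"
        using \<psi> N.rcos_sum N.mem_carrier N.rcos_const[OF is_group]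
        by (simp add: annihilator_simps hom_complex_units_iff)
    next
      fix \<phi> \<psi>
      show "?\<pi> (\<phi> \<otimes>\<^bsub>character_group (G Mod N)\<^esub> \<psi>) = ?\<pi> \<phi> \<otimes>\<^bsub>annihilator G N\<^esub> ?\<pi> \<psi>"
        by (auto simp: character_group_simps annihilator_simps carrier fun_eq_iff)
    qed
    show "bij_betw ?\<pi> (carrier (character_group (G Mod N))) (carrier (annihilator G N))"
      unfolding bij_betw_def
    proof (intro conjI inj_onI equalityI subsetI)
      fix \<phi> \<psi> assume h: "\<phi> \<in> carrier (character_group (G Mod N))"
        "\<psi> \<in> carrier (character_group (G Mod N))" "?\<pi> \<phi> = ?\<pi> \<psi>"
      show "\<phi> = \<psi>"
      proof (rule extensionalityI)
        fix u assume "u \<in> carrier (G Mod N)"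
        then obtain x where "x \<in> carrier G" "u = N #> x" by (auto simp: carrier)
        then show "\<phi> u = \<psi> u" using fun_cong[OF h(3), of x] by simp
      qed (use h in \<open>simp_all add: character_group_simps\<close>)
    next
      fix \<chi> assume "\<chi> \<in> ?\<pi> ` carrier (character_group (G Mod N))"
      then show "\<chi> \<in> carrier (annihilator G N)" using hom_carrier[OF hom] by blast
    next
      fix \<chi> assume \<chi>: "\<chi> \<in> carrier (annihilator G N)"
      interpret \<chi>: group_hom G complex_units \<chi>
        using \<chi> by unfold_locales (simp add: annihilator_simps)
      have "N \<subseteq> kernel G complex_units \<chi>"
        using \<chi> N.mem_carrier by (auto simp: kernel_def annihilator_simps)
      then obtain \<psi> where \<psi>: "\<psi> \<in> hom (G Mod N) complex_units"
        "\<And>x. x \<in> carrier G \<Longrightarrow> \<psi> (N #> x) = \<chi> x"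
        by (rule \<chi>.FactGroup_universal_kernel[OF N.normal_axioms]) (rule that)
      let ?\<psi> = "restrict \<psi> (carrier (G Mod N))"
      have closed: "N #> x <#> (N #> y) \<in> carrier (G Mod N)" if "x \<in> carrier G" "y \<in> carrier G" for x y
        using that N.rcos_sum by (auto simp: carrier)
      have "?\<psi> \<in> carrier (character_group (G Mod N))"
        using \<psi>(1) closed by (auto simp: character_group_simps hom_complex_units_iff carrier)
      moreover have "?\<pi> ?\<psi> = \<chi>"
        by (rule extensionalityI[of _ "carrier G"])
          (use \<chi> \<psi>(2) in \<open>auto simp: annihilator_simps carrier\<close>)
      ultimately show "\<chi> \<in> ?\<pi> ` carrier (character_group (G Mod N))"
        by (intro image_eqI[of _ _ ?\<psi>]) simp_all
    qed
  qed
  then show ?thesis by (auto simp: is_iso_def)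
qed

text \<open>Commutativity makes the set product of a finite cyclic subgroup and a finite subgroup
  again a finite subgroup, so generators of finite order can be adjoined one at a time.\<close>

lemma finite_subgroup_containing:
  assumes "finite T" "T \<subseteq> carrier G" "\<And>x. x \<in> T \<Longrightarrow> ord x > 0"
  shows "\<exists>H. subgroup H G \<and> finite H \<and> T \<subseteq> H"
  using assms
proof (induction T rule: finite_induct)
  case empty
  show ?case by (intro exI[of _ "{\<one>}"]) (simp add: triv_subgroup)
next
  case (insert x T)
  then obtain H where H: "subgroup H G" "finite H" "T \<subseteq> H" by auto
  let ?P = "generate G {x}"
  have x: "x \<in> carrier G" "ord x > 0" using insert.prems by auto
  have P: "subgroup ?P G" by (rule generate_is_subgroup) (use x in simp)
  have "card ?P = ord x" using generate_pow_card[OF x(1)] by simp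
  then have "finite ?P" using x(2) card_gt_0_iff by metis
  then have "finite (?P <#> H)" using H(2) by (simp add: set_mult_def)
  moreover have "subgroup (?P <#> H) G" by (rule mult_subgroups[OF P H(1)])
  moreover have "u \<in> ?P <#> H" if "u \<in> T" for u
  proof -
    have u: "u \<in> H" "u \<in> carrier G" using that H(3) insert.prems(1) by auto
    have "\<one> \<otimes> u \<in> ?P <#> H"
      unfolding set_mult_def using u(1) subgroup.one_closed[OF P] by auto
    then show ?thesis using u(2) by simp
  qed
  moreover have "x \<in> ?P <#> H"
  proof -
    have "x \<in> ?P" by (rule generate.incl) simp
    then have "x \<otimes> \<one> \<in> ?P <#> H"
      unfolding set_mult_def using subgroup.one_closed[OF H(1)] by auto
    then show ?thesis using x(1) by simp
  qed
  ultimately show ?case by (intro exI[of _ "?P <#> H"]) auto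
qed

end

section \<open>The transgression\<close>

context lie_presentation
begin

lemma relators_derived_subgroups:
  "subgroup relators (add_monoid F)" "subgroup lie_derived (add_monoid F)"
  "subgroup lie_central (add_monoid F)" "subgroup (relators \<inter> lie_derived) (add_monoid F)"
proof -
  interpret R: lie_subring relators F by (rule relators_lie_subring)
  interpret D: lie_subring lie_derived F by (rule derived_lie_subring)
  interpret C: lie_subring lie_central F by (rule central_lie_subring)
  show "subgroup relators (add_monoid F)" "subgroup lie_derived (add_monoid F)"
    "subgroup lie_central (add_monoid F)"
    by (rule R.a_subgroup D.a_subgroup C.a_subgroup)+
  then show "subgroup (relators \<inter> lie_derived) (add_monoid F)"
    using group.subgroups_Inter_pair[OF a_group] by blast
qed

lemma in_carrier:
  "x \<in> relators \<Longrightarrow> x \<in> carrier F" "x \<in> lie_derived \<Longrightarrow> x \<in> carrier F"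
  "x \<in> lie_central \<Longrightarrow> x \<in> carrier F"
  using relators_derived_subgroups(1-3)[THEN subgroup.subset] by auto

lemma diff_in_relators:
  assumes "x \<in> carrier F" "y \<in> carrier F" "q x = q y"
  shows "x \<ominus> y \<in> relators" "x = (x \<ominus> y) \<oplus> y"
  using assms by (simp_all add: relators_def a_minus_def L.r_neg a_assoc l_neg)

text \<open>Modulo \<open>[F, R]\<close> the bracket depends only on images in \<open>L\<close>;
  both surjectivity and finiteness rest on this. Replacing \<open>y\<close> and then
  \<open>x\<close> leaves two error terms. The second has its relator on the left, and antisymmetry
  moves it to the side used by \<open>lie_central\<close>.\<close>

lemma bracket_mod_central:
  assumes h: "x \<in> carrier F" "x' \<in> carrier F" "y \<in> carrier F" "y' \<in> carrier F" "q x = q x'" "q y = q y'"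
  obtains z where "z \<in> lie_central" "x \<otimes> y = z \<oplus> x' \<otimes> y'"
proof
  interpret C: lie_subring lie_central F by (rule central_lie_subring)
  note rx = diff_in_relators[OF h(1,2,5)] and ry = diff_in_relators[OF h(3,4,6)]
  let ?u = "x \<otimes> (y \<ominus> y')" and ?v = "y' \<otimes> (x \<ominus> x')"
  have uv: "?u \<in> lie_central" "?v \<in> lie_central" using bracket_in_central rx(1) ry(1) h by auto
  show "?u \<oplus> \<ominus> ?v \<in> lie_central" by (intro C.a_closed C.a_inv_closed uv)
  have "x \<otimes> y = ?u \<oplus> x \<otimes> y'"
    using bracket_add_right[of x "y \<ominus> y'" y'] ry h by simp
  also have "x \<otimes> y' = (x \<ominus> x') \<otimes> y' \<oplus> x' \<otimes> y'"
    using bracket_add_left[of "x \<ominus> x'" x' y'] rx h by simp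
  also have "(x \<ominus> x') \<otimes> y' = \<ominus> ?v"
    using h by (intro bracket_commute) auto
  finally show "x \<otimes> y = (?u \<oplus> \<ominus> ?v) \<oplus> x' \<otimes> y'"
    using h by (simp add: a_assoc bracket_closed)
qed

text \<open>Only addition is retained: brackets of relators already lie in
  \<open>lie_central\<close>, so the bracket of the quotient is zero.\<close>

abbreviation "derived_relators \<equiv> add_monoid (F\<lparr>carrier := relators \<inter> lie_derived\<rparr>)"

lemma comm_group_derived_relators: "comm_group derived_relators"
  using group.group_comm_groupI[OF subgroup.subgroup_is_group[OF relators_derived_subgroups(4) a_group]]
    in_carrier a_comm by simp

lemma central_subgroup: "subgroup lie_central derived_relators"
  using group.subgroup_incl[OF a_group relators_derived_subgroups(3,4) central_subset] by simp

definition transgression :: "('b \<times> 'b \<Rightarrow> complex) \<times> ('b \<times> 'b \<Rightarrow> complex) \<Rightarrow> 'a \<Rightarrow> complex" where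
  "transgression = (\<lambda>(f, g). \<lambda>x\<in>relators \<inter> lie_derived. (SOME c. lift f g c) x)"

lemma transgression_eq:
  assumes c: "lift f g c"
  shows "transgression (f, g) = restrict c (relators \<inter> lie_derived)"
proof -
  have "lift f g (SOME c. lift f g c)" using c by (rule someI[where P = "lift f g"])
  from lift_unique[OF this c] show ?thesis by (auto simp: transgression_def)
qed

lemma transgression_in_annihilator:
  assumes c: "lift f g c"
  shows "transgression (f, g) \<in> carrier (annihilator derived_relators lie_central)"
proof -
  interpret S: subgroup "relators \<inter> lie_derived" "add_monoid F" by (rule relators_derived_subgroups)
  show ?thesis
    using liftD(2)[OF c] lift_on_relators(1)[OF c] lift_on_central[OF c] in_carrier S.m_closed central_subset
    by (auto simp: transgression_eq[OF c] annihilator_simps hom_complex_units_iff)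
qed

lemma cochain2_simps:
  "(f, g) \<in> carrier (cochain2 L complex_units) \<longleftrightarrow>
     f \<in> (\<Pi>\<^sub>E p\<in>carrier L \<times> carrier L. - {0}) \<and> g \<in> (\<Pi>\<^sub>E p\<in>carrier L \<times> carrier L. - {0})"
  "(f, g) \<otimes>\<^bsub>cochain2 L complex_units\<^esub> (f', g') =
     (\<lambda>p\<in>carrier L \<times> carrier L. f p * f' p, \<lambda>p\<in>carrier L \<times> carrier L. g p * g' p)"
  "\<one>\<^bsub>cochain2 L complex_units\<^esub> =
     (\<lambda>p\<in>carrier L \<times> carrier L. 1, \<lambda>p\<in>carrier L \<times> carrier L. 1)"
  by (simp_all add: cochain2_def)

lemma group_cochain2: "group (cochain2 L complex_units)"
  unfolding cochain2_def by (intro DirProd_group) (simp_all add: complex_units.is_group)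

lemma cochain2_inv:
  assumes "(f, g) \<in> carrier (cochain2 L complex_units)"
  shows "inv\<^bsub>cochain2 L complex_units\<^esub> (f, g) =
    (\<lambda>p\<in>carrier L \<times> carrier L. inverse (f p), \<lambda>p\<in>carrier L \<times> carrier L. inverse (g p))"
  by (rule group.inv_equality[OF group_cochain2])
    (use assms in \<open>auto simp: cochain2_simps PiE_iff fun_eq_iff\<close>)

lemma trivial_lift: "lift (\<lambda>p\<in>carrier L \<times> carrier L. 1) (\<lambda>p\<in>carrier L \<times> carrier L. 1) (\<lambda>_. 1)"
  by (simp add: lift_def)

end

section \<open>Free presentations: cohomology as a group of characters\<close>

locale free_lie_presentation = lie_presentation +
  fixes B
  assumes basis: "lie_basis F B"
begin

text \<open>The point where freeness is used: it supplies the lift of a given cocycle. Subsequent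
  arguments manipulate lifts in place of the cocycle identities.\<close>

lemma Z2_iff:
  "(f, g) \<in> carrier (Z2 L complex_units) \<longleftrightarrow>
     (f, g) \<in> carrier (cochain2 L complex_units) \<and> (\<exists>c. lift f g c)"
proof -
  have "\<exists>c. lift f g c" if "(f, g) \<in> carrier (cochain2 L complex_units)" "cocycle2 L complex_units f g"
  proof (rule lift_exists[OF basis \<open>cocycle2 L complex_units f g\<close>])
    show "f (x, y) \<noteq> 0" "g (x, y) \<noteq> 0" if "x \<in> carrier L" "y \<in> carrier L" for x y
      using that \<open>(f, g) \<in> _\<close> by (auto simp: cochain2_simps PiE_iff)
  qed blast
  then show ?thesis by (auto simp: Z2_def cocycle2_of_lift)
qed

lemma subgroup_Z2: "subgroup (carrier (Z2 L complex_units)) (cochain2 L complex_units)"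
proof (rule group.subgroupI[OF group_cochain2])
  show "carrier (Z2 L complex_units) \<subseteq> carrier (cochain2 L complex_units)"
    by (auto simp: Z2_def)
  have "\<one>\<^bsub>cochain2 L complex_units\<^esub> \<in> carrier (Z2 L complex_units)"
    using trivial_lift by (auto simp: Z2_iff cochain2_simps)
  then show "carrier (Z2 L complex_units) \<noteq> {}" by blast
next
  fix u assume u: "u \<in> carrier (Z2 L complex_units)"
  obtain f g where fg: "u = (f, g)" by (cases u)
  obtain c where c: "lift f g c" using u fg by (auto simp: Z2_iff)
  have "(f, g) \<in> carrier (cochain2 L complex_units)" using u fg by (simp add: Z2_iff)
  moreover have "lift (\<lambda>p\<in>carrier L \<times> carrier L. inverse (f p))
      (\<lambda>p\<in>carrier L \<times> carrier L. inverse (g p)) (\<lambda>x. inverse (c x))"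
    by (rule lift_inverse[OF c]) simp_all
  ultimately show "inv\<^bsub>cochain2 L complex_units\<^esub> u \<in> carrier (Z2 L complex_units)"
    unfolding fg by (auto simp: cochain2_inv Z2_iff cochain2_simps PiE_iff)
next
  fix u v assume uv: "u \<in> carrier (Z2 L complex_units)" "v \<in> carrier (Z2 L complex_units)"
  obtain f g f' g' where fg: "u = (f, g)" "v = (f', g')" by (cases u, cases v)
  obtain c c' where c: "lift f g c" "lift f' g' c'" using uv fg by (auto simp: Z2_iff)
  have "lift (\<lambda>p\<in>carrier L \<times> carrier L. f p * f' p) (\<lambda>p\<in>carrier L \<times> carrier L. g p * g' p) (\<lambda>x. c x * c' x)"
    by (rule lift_mult[OF c]) simp_all
  then show "u \<otimes>\<^bsub>cochain2 L complex_units\<^esub> v \<in> carrier (Z2 L complex_units)"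
    using uv unfolding fg by (auto simp: cochain2_simps Z2_iff PiE_iff)
qed

lemma group_Z2: "group (Z2 L complex_units)"
  using subgroup.subgroup_is_group[OF subgroup_Z2 group_cochain2] by (simp add: Z2_def)

lemma transgression_hom:
  "transgression \<in> hom (Z2 L complex_units) (annihilator derived_relators lie_central)"
proof (rule homI)
  fix u assume "u \<in> carrier (Z2 L complex_units)"
  then show "transgression u \<in> carrier (annihilator derived_relators lie_central)"
    using transgression_in_annihilator by (cases u) (auto simp: Z2_iff)
next
  fix u v assume uv: "u \<in> carrier (Z2 L complex_units)" "v \<in> carrier (Z2 L complex_units)"
  obtain f g f' g' where fg: "u = (f, g)" "v = (f', g')" by (cases u, cases v)
  obtain c c' where c: "lift f g c" "lift f' g' c'" using uv fg by (auto simp: Z2_iff)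
  have "lift (\<lambda>p\<in>carrier L \<times> carrier L. f p * f' p) (\<lambda>p\<in>carrier L \<times> carrier L. g p * g' p) (\<lambda>x. c x * c' x)"
    by (rule lift_mult[OF c]) simp_all
  moreover have "u \<otimes>\<^bsub>Z2 L complex_units\<^esub> v =
      (\<lambda>p\<in>carrier L \<times> carrier L. f p * f' p, \<lambda>p\<in>carrier L \<times> carrier L. g p * g' p)"
    unfolding fg by (simp add: Z2_def cochain2_simps)
  ultimately show "transgression (u \<otimes>\<^bsub>Z2 L complex_units\<^esub> v) =
      transgression u \<otimes>\<^bsub>annihilator derived_relators lie_central\<^esub> transgression v"
    unfolding fg by (simp add: transgression_eq transgression_eq[OF c(1)] transgression_eq[OF c(2)]
        annihilator_simps fun_eq_iff)
qed

text \<open>The coboundary of \<open>t\<close> has the lift \<open>inverse (t (q x))\<close>, which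
  is 1 on relators because \<open>t\<close> is normalized at zero.\<close>

lemma B2_subset_kernel:
  "B2 L complex_units \<subseteq> kernel (Z2 L complex_units) (annihilator derived_relators lie_central) transgression"
proof
  fix u assume "u \<in> B2 L complex_units"
  then obtain t where t: "t \<in> carrier L \<rightarrow> - {0}" "t \<zero>\<^bsub>L\<^esub> = 1"
    and u: "u = (\<lambda>(x, y) \<in> carrier L \<times> carrier L. inv\<^bsub>complex_units\<^esub> t (x \<otimes>\<^bsub>L\<^esub> y),
       \<lambda>(x, y) \<in> carrier L \<times> carrier L. t x * t y * inv\<^bsub>complex_units\<^esub> t (x \<oplus>\<^bsub>L\<^esub> y))"
    by (auto simp: B2_def)
  have nz: "t x \<noteq> 0" if "x \<in> carrier L" for x using t(1) that by auto
  obtain f g where fg: "u = (f, g)" by (cases u)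
  have f: "f = (\<lambda>(x, y) \<in> carrier L \<times> carrier L. inverse (t (x \<otimes>\<^bsub>L\<^esub> y)))"
    and g: "g = (\<lambda>(x, y) \<in> carrier L \<times> carrier L. t x * t y * inverse (t (x \<oplus>\<^bsub>L\<^esub> y)))"
    using u fg nz L.bracket_closed by (auto intro!: restrict_ext)
  have c: "lift f g (\<lambda>x. inverse (t (q x)))"
    unfolding lift_def f g using nz t(2) by (simp add: field_simps)
  have "(f, g) \<in> carrier (cochain2 L complex_units)"
    unfolding cochain2_simps f g using nz L.bracket_closed by auto
  then have "u \<in> carrier (Z2 L complex_units)" unfolding fg using c by (auto simp: Z2_iff)
  moreover have "transgression u = \<one>\<^bsub>annihilator derived_relators lie_central\<^esub>"
    unfolding fg using transgression_eq[OF c] t(2)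
    by (auto simp: annihilator_simps fun_eq_iff relators_def)
  ultimately show "u \<in> kernel (Z2 L complex_units) (annihilator derived_relators lie_central) transgression"
    by (simp add: kernel_def)
qed

lemma kernel_subset_B2:
  "kernel (Z2 L complex_units) (annihilator derived_relators lie_central) transgression \<subseteq> B2 L complex_units"
proof
  fix u assume u: "u \<in> kernel (Z2 L complex_units) (annihilator derived_relators lie_central) transgression"
  obtain f g where fg: "u = (f, g)" by (cases u)
  have cochain: "(f, g) \<in> carrier (cochain2 L complex_units)"
    and ker: "transgression (f, g) = \<one>\<^bsub>annihilator derived_relators lie_central\<^esub>"
    using u by (auto simp: fg kernel_def Z2_iff)
  obtain c where c: "lift f g c" using u by (auto simp: fg kernel_def Z2_iff)
  have c1: "c x = 1" if "x \<in> relators" "x \<in> lie_derived" for x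
    using fun_cong[OF ker, of x] that by (simp add: transgression_eq[OF c] annihilator_simps)
  \<comment> \<open>The kernel condition says that \<open>c\<close> is trivial on
    \<open>R \<inter> F^2\<close>, exactly what is needed to prescribe \<open>c\<close> on
    \<open>R\<close> and 1 on \<open>F^2\<close> at once. Division by \<open>\<chi>\<close> then
    leaves the pair \<open>(f, g)\<close> unchanged.\<close>
  obtain \<chi> where \<chi>: "\<chi> \<in> hom (add_monoid F) complex_units"
    "\<And>x. x \<in> relators \<Longrightarrow> \<chi> x = c x" "\<And>x. x \<in> lie_derived \<Longrightarrow> \<chi> x = 1"
    by (rule comm_group.character_extending_trivially[OF a_comm_group relators_derived_subgroups(1,2), of c])
      (use lift_on_relators(1)[OF c] liftD(2)[OF c] in_carrier c1 that in auto)
  have \<chi>nz: "\<chi> x \<noteq> 0" and \<chi>add: "\<chi> (x \<oplus> y) = \<chi> x * \<chi> y"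
    if "x \<in> carrier F" "y \<in> carrier F" for x y
    using \<chi>(1) that by (auto simp: hom_complex_units_iff)
  define c' where "c' x = c x / \<chi> x" for x
  have "\<chi> \<zero> = 1" using \<chi>nz[of \<zero> \<zero>] \<chi>add[of \<zero> \<zero>] by simp
  then have c': "lift f g c'"
    using liftD[OF c] \<chi>nz \<chi>add \<chi>(3) bracket_in_derived by (simp add: lift_def c'_def)
  have c'1: "c' x = 1" if "x \<in> relators" for x
    using \<chi>(2)[OF that] liftD(2)[OF c] in_carrier(1)[OF that] by (simp add: c'_def)
  have c'_cong: "c' x = c' y" if xy: "x \<in> carrier F" "y \<in> carrier F" "q x = q y" for x y
  proof -
    note r = diff_in_relators[OF xy]
    have "c' x = c' (x \<ominus> y) * c' y" using lift_on_relators(1)[OF c' r(1) xy(2)] r(2) by simp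
    then show ?thesis using c'1[OF r(1)] by simp
  qed
  \<comment> \<open>Any preimage may be taken, as \<open>c'\<close> is constant on the fibres of
    \<open>q\<close>. The inverse accounts for the sign in the definition of coboundaries.\<close>
  define t where "t l = inverse (c' (inv_into (carrier F) q l))" for l
  have t: "t (q x) = inverse (c' x)" if "x \<in> carrier F" for x
  proof -
    have "inv_into (carrier F) q (q x) \<in> carrier F" "q (inv_into (carrier F) q (q x)) = q x"
      using that by (auto intro: inv_into_into f_inv_into_f)
    then show ?thesis using c'_cong[OF _ that] by (simp add: t_def)
  qed
  have tnz: "t l \<noteq> 0" if "l \<in> carrier L" for l
    using that t liftD(2)[OF c'] by (auto elim!: q_preimage)
  have t0: "t \<zero>\<^bsub>L\<^esub> = 1" using t[of \<zero>] liftD(1)[OF c'] by simp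
  have ext: "f \<in> extensional (carrier L \<times> carrier L)" "g \<in> extensional (carrier L \<times> carrier L)"
    using cochain by (auto simp: cochain2_simps PiE_iff)
  have f: "f (x, y) = inv\<^bsub>complex_units\<^esub> t (x \<otimes>\<^bsub>L\<^esub> y)" if xy: "x \<in> carrier L" "y \<in> carrier L" for x y
  proof -
    obtain a b where ab: "a \<in> carrier F" "b \<in> carrier F" "x = q a" "y = q b"
      using xy by (elim q_preimage)
    then show ?thesis
      using t[of "a \<otimes> b"] liftD(4)[OF c', of a b] tnz[of "x \<otimes>\<^bsub>L\<^esub> y"] L.bracket_closed[OF xy]
      by (simp add: bracket_closed)
  qed
  have g: "g (x, y) = t x * t y * inv\<^bsub>complex_units\<^esub> t (x \<oplus>\<^bsub>L\<^esub> y)" if xy: "x \<in> carrier L" "y \<in> carrier L" for x y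
  proof -
    obtain a b where ab: "a \<in> carrier F" "b \<in> carrier F" "x = q a" "y = q b"
      using xy by (elim q_preimage)
    have "inv\<^bsub>complex_units\<^esub> t (x \<oplus>\<^bsub>L\<^esub> y) = c' (a \<oplus> b)"
      using tnz[of "x \<oplus>\<^bsub>L\<^esub> y"] t[of "a \<oplus> b"] xy ab by simp
    then show ?thesis
      using t[of a] t[of b] lift_g[OF c', of a b] ab by (simp add: field_simps)
  qed
  have "f = (\<lambda>(x, y) \<in> carrier L \<times> carrier L. inv\<^bsub>complex_units\<^esub> t (x \<otimes>\<^bsub>L\<^esub> y))"
    by (rule extensionalityI[OF ext(1)]) (use f in auto)
  moreover have "g = (\<lambda>(x, y) \<in> carrier L \<times> carrier L. t x * t y * inv\<^bsub>complex_units\<^esub> t (x \<oplus>\<^bsub>L\<^esub> y))"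
    by (rule extensionalityI[OF ext(2)]) (use g in auto)
  ultimately show "u \<in> B2 L complex_units"
    unfolding fg B2_def using tnz t0 by (auto intro!: exI[of _ t])
qed

text \<open>After extension of \<open>\<chi>\<close> to an additive character \<open>\<psi>\<close>
  of \<open>F\<close>, triviality on \<open>[F, R]\<close> makes
  \<open>\<psi> (x \<otimes> y)\<close> a function of \<open>q x\<close> and \<open>q y\<close>. The
  lift is \<open>\<psi>\<close> divided by its values at coset representatives.\<close>

lemma transgression_surj:
  assumes \<chi>: "\<chi> \<in> carrier (annihilator derived_relators lie_central)"
  shows "\<chi> \<in> transgression ` carrier (Z2 L complex_units)"
proof -
  obtain \<psi> where \<psi>: "\<psi> \<in> hom (add_monoid F) complex_units"
    "\<And>x. x \<in> relators \<inter> lie_derived \<Longrightarrow> \<psi> x = \<chi> x" "\<And>x. x \<in> {\<zero>} \<Longrightarrow> \<psi> x = 1"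
  proof (rule comm_group.character_extending_trivially[OF a_comm_group relators_derived_subgroups(4), of "{\<zero>}" \<chi>])
    show "subgroup {\<zero>} (add_monoid F)" using group.triv_subgroup[OF a_group] by simp
    show "\<chi> x = 1" if "x \<in> {\<zero>}" for x
      using that \<chi> subgroup.one_closed[OF relators_derived_subgroups(3)] by (simp add: annihilator_simps)
  qed (use \<chi> that in \<open>auto simp: annihilator_simps hom_complex_units_iff\<close>)
  have \<psi>nz: "\<psi> x \<noteq> 0" and \<psi>add: "\<psi> (x \<oplus> y) = \<psi> x * \<psi> y"
    if "x \<in> carrier F" "y \<in> carrier F" for x y
    using \<psi>(1) that by (auto simp: hom_complex_units_iff)
  have \<psi>central: "\<psi> x = 1" if "x \<in> lie_central" for x
    using \<psi>(2)[of x] that central_subset \<chi> by (auto simp: annihilator_simps)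
  have bracket_cong: "\<psi> (x \<otimes> y) = \<psi> (x' \<otimes> y')"
    if h: "x \<in> carrier F" "x' \<in> carrier F" "y \<in> carrier F" "y' \<in> carrier F" "q x = q x'" "q y = q y'"
    for x y x' y'
  proof -
    obtain z where z: "z \<in> lie_central" "x \<otimes> y = z \<oplus> x' \<otimes> y'"
      using h by (rule bracket_mod_central)
    then show ?thesis using \<psi>add[of z "x' \<otimes> y'"] \<psi>central h in_carrier(3) by (simp add: bracket_closed)
  qed
  \<comment> \<open>Zero is chosen explicitly to represent the zero coset, whose other members are
    nonzero relators. Hence division by \<open>\<psi> (s (q x))\<close> does not disturb the values
    on \<open>R\<close>.\<close>
  define s where "s l = (if l = \<zero>\<^bsub>L\<^esub> then \<zero> else inv_into (carrier F) q l)" for l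
  have s: "s l \<in> carrier F" "q (s l) = l" if "l \<in> carrier L" for l
    using that q_surj by (auto simp: s_def intro: inv_into_into f_inv_into_f)
  have s0: "s \<zero>\<^bsub>L\<^esub> = \<zero>" by (simp add: s_def)
  \<comment> \<open>Both maps are read off from
    \<open>x \<mapsto> \<psi> x / \<psi> (s (q x))\<close>: \<open>f\<close> from its values at
    brackets, \<open>g\<close> as the failure of \<open>\<psi>\<close> composed with
    \<open>s\<close> to be additive.\<close>
  define f where "f = (\<lambda>(l, m)\<in>carrier L \<times> carrier L. \<psi> (s l \<otimes> s m) / \<psi> (s (l \<otimes>\<^bsub>L\<^esub> m)))"
  define g where "g = (\<lambda>(l, m)\<in>carrier L \<times> carrier L. \<psi> (s l) * \<psi> (s m) / \<psi> (s (l \<oplus>\<^bsub>L\<^esub> m)))"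
  have \<psi>s: "\<psi> (s l) \<noteq> 0" if "l \<in> carrier L" for l using \<psi>nz s that by blast
  have c: "lift f g (\<lambda>x. \<psi> x / \<psi> (s (q x)))"
    unfolding lift_def
  proof (intro conjI ballI)
    show "\<psi> \<zero> / \<psi> (s (q \<zero>)) = 1" using \<psi>(3) by (simp add: s0)
  next
    fix x assume "x \<in> carrier F"
    then show "\<psi> x / \<psi> (s (q x)) \<noteq> 0" using \<psi>nz \<psi>s by simp
  next
    fix x y assume xy: "x \<in> carrier F" "y \<in> carrier F"
    then show "\<psi> (x \<oplus> y) / \<psi> (s (q (x \<oplus> y))) = \<psi> x / \<psi> (s (q x)) * (\<psi> y / \<psi> (s (q y))) * g (q x, q y)"
      using \<psi>s[of "q x"] \<psi>s[of "q y"] by (simp add: g_def \<psi>add)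
    show "\<psi> (x \<otimes> y) / \<psi> (s (q (x \<otimes> y))) = f (q x, q y)"
      using xy bracket_cong[of x "s (q x)" y "s (q y)"] s by (simp add: f_def)
  qed
  have "(f, g) \<in> carrier (cochain2 L complex_units)"
    unfolding cochain2_simps f_def g_def
    using \<psi>s \<psi>nz[where y = \<zero>] s(1) bracket_closed L.bracket_closed by auto
  then have "(f, g) \<in> carrier (Z2 L complex_units)" using c by (auto simp: Z2_iff)
  moreover have "transgression (f, g) = \<chi>"
    unfolding transgression_eq[OF c]
  proof (rule extensionalityI)
    fix x assume "x \<in> relators \<inter> lie_derived"
    then show "(\<lambda>x\<in>relators \<inter> lie_derived. \<psi> x / \<psi> (s (q x))) x = \<chi> x"
      using \<psi>(2,3) s0 by (simp add: relators_def)
  qed (use \<chi> in \<open>simp_all add: annihilator_simps\<close>)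
  ultimately show ?thesis by (intro image_eqI[of _ _ "(f, g)"]) simp_all
qed

theorem H2_iso_annihilator: "H2 L complex_units \<cong> annihilator derived_relators lie_central"
proof -
  interpret group_hom "Z2 L complex_units" "annihilator derived_relators lie_central" transgression
    using group_Z2 comm_group.group_annihilator[OF comm_group_derived_relators central_subgroup] transgression_hom
    by (simp add: group_hom_def group_hom_axioms_def)
  have "transgression ` carrier (Z2 L complex_units) = carrier (annihilator derived_relators lie_central)"
    using transgression_surj hom_carrier[OF transgression_hom] by blast
  then have "Z2 L complex_units Mod kernel (Z2 L complex_units) (annihilator derived_relators lie_central) transgression
      \<cong> annihilator derived_relators lie_central"
    by (rule FactGroup_iso)
  moreover have "kernel (Z2 L complex_units) (annihilator derived_relators lie_central) transgression = B2 L complex_units"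
    using B2_subset_kernel kernel_subset_B2 by blast
  ultimately show ?thesis by (simp add: H2_def)
qed

end

section \<open>Finiteness\<close>

text \<open>In \<open>F/[F, R]\<close> there are only finitely many brackets, as they depend only on
  pairs from the finite \<open>L\<close>, and each has finite order. They lie in a finite subgroup,
  which then contains the image of \<open>F^2\<close>.\<close>

lemma (in lie_presentation) finite_schur_multiplier:
  assumes fin: "finite (carrier L)"
  shows "finite (carrier (derived_relators Mod lie_central))"
proof -
  let ?G = "add_monoid F" and ?A = "add_monoid F Mod lie_central"
  define \<pi> where "\<pi> x = lie_central #>\<^bsub>?G\<^esub> x" for x
  interpret N: normal lie_central ?G
    by (rule comm_group.subgroup_imp_normal[OF a_comm_group relators_derived_subgroups(3)])
  interpret A: comm_group ?A by (rule comm_group.abelian_FactGroup[OF a_comm_group relators_derived_subgroups(3)])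
  interpret \<pi>: group_hom ?G ?A \<pi>
    using N.r_coset_hom_Mod by unfold_locales (simp add: \<pi>_def[abs_def])
  have \<pi>_add: "\<pi> (x \<oplus> y) = \<pi> x \<otimes>\<^bsub>?A\<^esub> \<pi> y" if "x \<in> carrier F" "y \<in> carrier F" for x y
    using \<pi>.hom_mult[of x y] that by simp
  have \<pi>_mem: "\<pi> x \<in> carrier ?A" if "x \<in> carrier F" for x
    using \<pi>.hom_closed[of x] that by simp
  have \<pi>_zero: "\<pi> \<zero> = \<one>\<^bsub>?A\<^esub>" using \<pi>.hom_one by simp
  have \<pi>_central: "\<pi> z = \<one>\<^bsub>?A\<^esub>" if "z \<in> lie_central" for z
    using N.rcos_const[OF a_group that] by (simp add: \<pi>_def)
  define s where "s = inv_into (carrier F) q"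
  have s: "s l \<in> carrier F" "q (s l) = l" if "l \<in> carrier L" for l
    using that q_surj by (auto simp: s_def intro: inv_into_into f_inv_into_f)
  let ?T = "(\<lambda>(l, m). \<pi> (s l \<otimes> s m)) ` (carrier L \<times> carrier L)"
  have bracket_in_T: "\<pi> (x \<otimes> y) \<in> ?T" if xy: "x \<in> carrier F" "y \<in> carrier F" for x y
  proof -
    have sq: "s (q x) \<in> carrier F" "s (q y) \<in> carrier F" "q x = q (s (q x))" "q y = q (s (q y))"
      using s xy by simp_all
    obtain z where z: "z \<in> lie_central" "x \<otimes> y = z \<oplus> s (q x) \<otimes> s (q y)"
      by (rule bracket_mod_central[OF xy(1) sq(1) xy(2) sq(2) sq(3,4)])
    then have "\<pi> (x \<otimes> y) = \<pi> (s (q x) \<otimes> s (q y))"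
      using \<pi>_add[of z "s (q x) \<otimes> s (q y)"] \<pi>_central[OF z(1)] in_carrier(3)[OF z(1)]
        \<pi>_mem[of "s (q x) \<otimes> s (q y)"] sq by (simp add: bracket_closed del: mult_FactGroup one_FactGroup)
    then show ?thesis using xy by (intro image_eqI[of _ _ "(q x, q y)"]) simp_all
  qed
  \<comment> \<open>By Lagrange, \<open>n\<close> times any \<open>y\<close> is a relator, so
    \<open>n\<close> times \<open>x \<otimes> y\<close>, being the bracket of \<open>x\<close> with
    that multiple, lies in \<open>[F, R]\<close>.\<close>
  let ?n = "order (add_monoid L)"
  have n: "?n > 0" using fin L.zero_closed by (auto simp: order_def card_gt_0_iff)
  have ord: "A.ord u > 0" if u: "u \<in> ?T" for u
  proof -
    obtain x y where xy: "x \<in> carrier F" "y \<in> carrier F" "u = \<pi> (x \<otimes> y)"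
      using u s(1) by auto
    have y_pow: "y [^]\<^bsub>?G\<^esub> k \<in> carrier F" for k :: nat
      using monoid.nat_pow_closed[OF group.is_monoid[OF a_group], of y k] xy(2) by simp
    have "q (y [^]\<^bsub>?G\<^esub> k) = q y [^]\<^bsub>add_monoid L\<^esub> k" for k :: nat
      using y_pow xy(2) by (induction k) simp_all
    then have "q (y [^]\<^bsub>?G\<^esub> ?n) = \<zero>\<^bsub>L\<^esub>"
      using group.pow_order_eq_1[OF L.a_group, of "q y"] xy(2) by simp
    then have "x \<otimes> (y [^]\<^bsub>?G\<^esub> ?n) \<in> lie_central"
      using xy(1) y_pow by (intro bracket_in_central) (simp_all add: relators_def)
    moreover have "u [^]\<^bsub>?A\<^esub> k = \<pi> (x \<otimes> (y [^]\<^bsub>?G\<^esub> k))" for k :: nat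
    proof (induction k)
      case 0
      show ?case using \<pi>_zero xy(1) by (simp add: bracket_zero)
    next
      case (Suc k)
      then show ?case
        using \<pi>_add[of "x \<otimes> (y [^]\<^bsub>?G\<^esub> k)" "x \<otimes> y"] xy y_pow[of k]
        by (simp add: bracket_add_right bracket_closed del: mult_FactGroup)
    qed
    ultimately have "u [^]\<^bsub>?A\<^esub> ?n = \<one>\<^bsub>?A\<^esub>" using \<pi>_central by simp
    moreover have "u \<in> carrier ?A" using \<pi>_mem xy by (simp add: bracket_closed)
    ultimately have "A.ord u dvd ?n" using A.pow_eq_id by blast
    then show ?thesis using n by (metis dvd_0_left_iff neq0_conv)
  qed
  have "?T \<subseteq> carrier ?A" using \<pi>_mem s(1) bracket_closed by auto
  moreover have "finite ?T" using fin by simp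
  ultimately obtain H where H: "subgroup H ?A" "finite H" "?T \<subseteq> H"
    using A.finite_subgroup_containing[of ?T] ord by blast
  have bracket: "x \<otimes> y \<in> {x \<in> carrier F. \<pi> x \<in> H}" if "x \<in> carrier F" "y \<in> carrier F" for x y
    using subsetD[OF H(3) bracket_in_T[OF that]] bracket_closed[OF that] by simp
  \<comment> \<open>Closure under the bracket needs no structure on \<open>H\<close>, since every
    bracket of \<open>F\<close> is sent into \<open>H\<close>.\<close>
  have "lie_subring {x \<in> carrier F. \<pi> x \<in> H} F"
  proof (rule lie_subringI[OF lie_ring_axioms])
    fix x assume x: "x \<in> {x \<in> carrier F. \<pi> x \<in> H}"
    then have "\<pi> (\<ominus> x) = inv\<^bsub>?A\<^esub> \<pi> x" using \<pi>.hom_inv[of x] by (simp add: a_inv_def)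
    then show "\<ominus> x \<in> {x \<in> carrier F. \<pi> x \<in> H}"
      using x subgroup.m_inv_closed[OF H(1)] by simp
  next
    fix x y assume xy: "x \<in> {x \<in> carrier F. \<pi> x \<in> H}" "y \<in> {x \<in> carrier F. \<pi> x \<in> H}"
    then show "x \<oplus> y \<in> {x \<in> carrier F. \<pi> x \<in> H}"
      using \<pi>_add[of x y] subgroup.m_closed[OF H(1)] by simp
    show "x \<otimes> y \<in> {x \<in> carrier F. \<pi> x \<in> H}"
      using xy bracket by simp
  qed (use \<pi>_zero subgroup.one_closed[OF H(1)] in auto)
  then have derived: "lie_derived \<subseteq> {x \<in> carrier F. \<pi> x \<in> H}"
    by (rule derived_minimal) (rule bracket)
  \<comment> \<open>A coset of \<open>lie_central\<close> is the same set whether formed in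
    \<open>R \<inter> F^2\<close> or in \<open>F\<close>.\<close>
  have "carrier (derived_relators Mod lie_central) = \<pi> ` (relators \<inter> lie_derived)"
    by (simp add: carrier_FactGroup \<pi>_def[abs_def] r_coset_def)
  also have "\<dots> \<subseteq> H" using derived by blast
  finally show ?thesis using H(2) by (rule finite_subset)
qed

theorem (in free_lie_presentation) H2_iso_schur_multiplier:
  assumes fin: "finite (carrier L)"
  shows "H2 L complex_units \<cong> derived_relators Mod lie_central"
proof -
  interpret S: comm_group derived_relators by (rule comm_group_derived_relators)
  let ?M = "derived_relators Mod lie_central"
  interpret M: comm_group ?M by (rule S.abelian_FactGroup[OF central_subgroup])
  interpret char_M: comm_group "character_group ?M"
    by (rule comm_group_character_group[OF M.monoid_axioms])
  have "H2 L complex_units \<cong> annihilator derived_relators lie_central" by (rule H2_iso_annihilator)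
  also have "\<dots> \<cong> character_group ?M"
    by (rule char_M.iso_sym[OF S.character_group_Mod_iso[OF central_subgroup]])
  also have "\<dots> \<cong> ?M"
    by (rule M.iso_sym[OF finite_comm_group_iso_character_group[OF M.comm_group_axioms
        finite_schur_multiplier[OF fin]]])
  finally show ?thesis .
qed

section \<open>The quotient of a Lie ring by an ideal\<close>

context lie_ideal
begin

text \<open>The product of two cosets under \<open>rcoset_mult\<close> is the union of the cosets of
  all products of representatives. Absorption of brackets on both sides makes these cosets equal, so
  the union is a single coset.\<close>

lemma rcoset_hom:
  assumes F: "lie_ring L"
  shows "(\<lambda>x. I +> x) \<in> lie_hom L (L Quot I)"
proof -
  interpret lie_ring L by fact
  interpret abelian_subgroup I L
    by (rule abelian_subgroupI3) (rule additive_subgroup_axioms, rule abelian_group_axioms)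
  have mult: "rcoset_mult L I (I +> x) (I +> y) = I +> (x \<otimes> y)"
    if xy: "x \<in> carrier L" "y \<in> carrier L" for x y
  proof -
    have "I +> (a \<otimes> b) = I +> (x \<otimes> y)" if ab: "a \<in> I +> x" "b \<in> I +> y" for a b
    proof -
      obtain r s where rs: "r \<in> I" "s \<in> I" "a = r \<oplus> x" "b = s \<oplus> y"
        using ab by (auto simp: a_r_coset_def')
      have b: "b \<in> carrier L" using rs xy by simp
      have "a \<otimes> b = (r \<otimes> b \<oplus> x \<otimes> s) \<oplus> x \<otimes> y"
        using rs xy b bracket_add_left[of r x b] bracket_add_right[of x s y]
        by (simp add: a_assoc bracket_closed)
      moreover have "r \<otimes> b \<oplus> x \<otimes> s \<in> I"
        using rs xy b bracket_mem_left bracket_mem_right by simp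
      ultimately have "a \<otimes> b \<in> I +> (x \<otimes> y)" by (auto simp: a_r_coset_def')
      then show ?thesis
        using a_repr_independence[of "a \<otimes> b" I "x \<otimes> y"] a_subgroup bracket_closed[OF xy] by simp
    qed
    moreover have "x \<in> I +> x" "y \<in> I +> y" using a_rcos_self xy by auto
    ultimately show ?thesis unfolding rcoset_mult_def by blast
  qed
  show ?thesis
    by (auto simp: lie_hom_def FactRing_def A_RCOSETS_def' a_rcos_sum mult)
qed

end

theorem theorem1p2:
  fixes F :: "('a, 'm) ring_scheme" and R :: "'a set" and L :: "'a set ring"
  assumes "free_lie_ring F" and "lie_ideal R F"
    and "L = F Quot R" and "finite (carrier L)"
  shows "H2 L complex_units \<cong>
    F\<lparr>carrier := R \<inter> lie_bracket F (carrier F) (carrier F)\<rparr> A_Mod lie_bracket F (carrier F) R"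
proof -
  obtain B where F: "lie_ring F" and B: "lie_basis F B"
    using assms(1) by (auto simp: free_lie_ring_def)
  interpret F: lie_ring F by fact
  interpret R: lie_ideal R F by fact
  interpret R: abelian_subgroup R F
    by (rule abelian_subgroupI3) (rule R.additive_subgroup_axioms, rule F.abelian_group_axioms)
  let ?q = "\<lambda>x. R +>\<^bsub>F\<^esub> x"
  have hom: "?q \<in> lie_hom F L" unfolding assms(3) by (rule R.rcoset_hom[OF F])
  have surj: "?q ` carrier F = carrier L"
    unfolding assms(3) by (auto simp: FactRing_def A_RCOSETS_def')
  have zero: "\<zero>\<^bsub>L\<^esub> = R" unfolding assms(3) by (simp add: FactRing_def)
  have coset_zero: "?q x = R \<longleftrightarrow> x \<in> R" if "x \<in> carrier F" for x
    using R.a_rcos_self[OF that] R.a_rcos_const by auto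
  \<comment> \<open>The quotient inherits the Lie axioms as a surjective image of \<open>F\<close>;
    its zero is the coset \<open>R\<close>.\<close>
  have L: "lie_ring L"
    by (rule lie_ring_surjective_image[OF F hom surj])
      (use coset_zero[of "\<zero>\<^bsub>F\<^esub>"] zero in simp)
  interpret free_lie_presentation F L ?q B
    by (intro free_lie_presentation.intro lie_presentation.intro lie_presentation_axioms.intro
        free_lie_presentation_axioms.intro F L hom surj B)
  have relators: "relators = R"
    using coset_zero R.a_subset unfolding relators_def zero by auto
  show ?thesis
    using H2_iso_schur_multiplier[OF assms(4)] unfolding relators A_FactGroup_def .
qed

end
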